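(* Let $\mathcal{A}$ be a unital complex algebra, $\psi:\mathcal{A}\to\mathbb{C}$ a unital linear functional, and $(\mathcal{A}_i)_{i\in I}$ unital subalgebras of $\mathcal{A}$ that are free relatively to $\psi$. Then for every $\alpha\in\mathbb{C}$ the subalgebras $T(\mathcal{A}_i)$, $i\in I$, of $T(\mathcal{A})$ are cyclically free relatively to $(\psi,\alpha[\psi])$.
   Context: Tensor algebra: $T(\mathcal{A})=\mathbb{C}1\oplus\bigoplus_{n\ge1}\mathcal{A}^{\otimes n}$ with product $\otimes$; $T(\mathcal{A}_i)=\mathbb{C}1\oplus\bigoplus_{n\ge1}\mathcal{A}_i^{\otimes n}$. The functional $\psi$ is extended to $T(\mathcal{A})$ by $\psi(a_1\otimes\cdots\otimes a_n)=\psi(a_1\cdots a_n)$, $\psi(1)=1$. Cyclic freeness: unital subalgebras $(\mathcal{B}_i)_{i\in I}$ of an algebra with a unital linear functional $\psi$ and a tracial (possibly non-unital) linear functional $\omega$ are cyclically free relatively to $(\psi,\omega)$ if they are free with respect to $\psi$ and, for every $n\ge2$ and $a_k\in\mathcal{B}_{j_k}$ ($1\le k\le n$) with $j_k\ne j_{k+1}$ for $1\le k\le n-1$, $j_n\neq j_1$, and $\psi(a_k)=0$ for all $k$, one has $\omega(a_1\cdots a_n)=0$. Boolean cumulants $\beta^\psi$ are defined recursively by $\psi(a_1\cdots a_n)=\sum_{I}\prod_{\{i,\ldots,j\}\in I}\beta^\psi(a_i,\ldots,a_j)$, the sum over interval partitions $I$ of $\{1,\ldots,n\}$. The functional $[\psi]$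 on $T(\mathcal{A})$ is defined by $[\psi](1)=1$ and $$[\psi](a_1\otimes\cdots\otimes a_n)=\sum_{\ell=1}^n\ \sum_{1\le i_1<\cdots<i_\ell\le n}\ \prod_{k=1}^{\ell}\beta^\psi(a_{i_k},a_{i_k+1},\ldots,a_{i_{k+1}-1}),$$ with $i_{\ell+1}=i_1$ and indices read cyclically modulo $n$ (the last factor is $\beta^\psi(a_{i_\ell},\ldots,a_n,a_1,\ldots,a_{i_1-1})$). *)

theory Defs
  imports Complex_Main "HOL-Library.Poly_Mapping"
begin

section \<open>Unital complex algebras\<close>

class scaleC =
  fixes scaleC :: "complex \<Rightarrow> 'a \<Rightarrow> 'a" (infixr "*\<^sub>C" 75)

class complex_algebra_1 = scaleC + ring_1 +
  assumes scaleC_add_right: "c *\<^sub>C (x + y) = c *\<^sub>C x + c *\<^sub>C y"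
    and scaleC_add_left: "(c + d) *\<^sub>C x = c *\<^sub>C x + d *\<^sub>C x"
    and scaleC_scaleC: "c *\<^sub>C (d *\<^sub>C x) = (c * d) *\<^sub>C x"
    and scaleC_one: "1 *\<^sub>C x = x"
    and mult_scaleC_left: "(c *\<^sub>C x) * y = c *\<^sub>C (x * y)"
    and mult_scaleC_right: "x * (c *\<^sub>C y) = c *\<^sub>C (x * y)"

global_interpretation complex_vector: vector_space "scaleC :: complex \<Rightarrow> 'a \<Rightarrow> 'a::complex_algebra_1"
  by unfold_locales (simp_all add: scaleC_add_right scaleC_add_left scaleC_scaleC scaleC_one)

abbreviation cspan :: "'a::complex_algebra_1 set \<Rightarrow> 'a set"
  where "cspan \<equiv> module.span scaleC"

abbreviation clinear :: "('a::complex_algebra_1 \<Rightarrow> complex) \<Rightarrow> bool"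
  where "clinear \<equiv> Vector_Spaces.linear scaleC (*)"

lemma clinear_iff:
  "clinear f \<longleftrightarrow> (\<forall>x y. f (x + y) = f x + f y) \<and> (\<forall>c x. f (c *\<^sub>C x) = c * f x)"
  unfolding Vector_Spaces.linear_iff
  by (auto intro!: complex_vector.vector_space_axioms vector_space.intro simp: algebra_simps)

definition unital_subalgebra :: "'a::complex_algebra_1 set \<Rightarrow> bool"
  where "unital_subalgebra S \<longleftrightarrow>
    1 \<in> S \<and> module.subspace scaleC S \<and> (\<forall>x\<in>S. \<forall>y\<in>S. x * y \<in> S)"

definition unital_functional :: "('a::complex_algebra_1 \<Rightarrow> complex) \<Rightarrow> bool"
  where "unital_functional \<psi> \<longleftrightarrow> clinear \<psi> \<and> \<psi> 1 = 1"

definition tracial_functional :: "('a::complex_algebra_1 \<Rightarrow> complex) \<Rightarrow> bool"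
  where "tracial_functional \<omega> \<longleftrightarrow> clinear \<omega> \<and> (\<forall>x y. \<omega> (x * y) = \<omega> (y * x))"

section \<open>Freeness and cyclic freeness\<close>

definition free_wrt ::
    "'i set \<Rightarrow> ('i \<Rightarrow> 'a::complex_algebra_1 set) \<Rightarrow> ('a \<Rightarrow> complex) \<Rightarrow> bool"
  where "free_wrt I B \<psi> \<longleftrightarrow>
    (\<forall>n\<ge>1. \<forall>j a.
      (\<forall>k<n. j k \<in> I \<and> a k \<in> B (j k) \<and> \<psi> (a k) = 0) \<longrightarrow>
      (\<forall>k. Suc k < n \<longrightarrow> j k \<noteq> j (Suc k)) \<longrightarrow>
      \<psi> (prod_list (map a [0..<n])) = 0)"

definition cyclically_free ::
    "'i set \<Rightarrow> ('i \<Rightarrow> 'a::complex_algebra_1 set) \<Rightarrow> ('a \<Rightarrow> complex) \<Rightarrow> ('a \<Rightarrow> complex) \<Rightarrow> bool"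
  where "cyclically_free I B \<psi> \<omega> \<longleftrightarrow>
    (\<forall>i\<in>I. unital_subalgebra (B i)) \<and> unital_functional \<psi> \<and> tracial_functional \<omega> \<and>
    free_wrt I B \<psi> \<and>
    (\<forall>n\<ge>2. \<forall>j a.
      (\<forall>k<n. j k \<in> I \<and> a k \<in> B (j k) \<and> \<psi> (a k) = 0) \<longrightarrow>
      (\<forall>k. Suc k < n \<longrightarrow> j k \<noteq> j (Suc k)) \<longrightarrow> j (n - 1) \<noteq> j 0 \<longrightarrow>
      \<omega> (prod_list (map a [0..<n])) = 0)"

section \<open>The tensor algebra\<close>

text \<open>
  The tensor algebra is the quotient of the complex vector space freely generated by the words
  over the algebra (with concatenation as product) by the span of the relations making
  words multilinear in their letters. The component spanned by words of length $n$ is the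
  $n$-fold tensor power over the complex numbers; the empty word is the unit.
  In particular the word with single letter \<open>1\<close> is not identified with the empty word.
\<close>

datatype 'a word = Word (letters: "'a list")

instantiation word :: (type) monoid_add
begin

definition "0 = Word []"
definition "v + w = Word (letters v @ letters w)"

instance
  by standard (simp_all add: zero_word_def plus_word_def)

end

instantiation complex :: complex_algebra_1
begin

definition "scaleC c (z::complex) = c * z"

instance
  by standard (simp_all add: scaleC_complex_def algebra_simps)

end

instantiation poly_mapping :: (monoid_add, complex_algebra_1) complex_algebra_1
begin

definition "scaleC c (p :: 'a \<Rightarrow>\<^sub>0 'b) = Poly_Mapping.single 0 (c *\<^sub>C 1) * p"

instance
proof
  fix c d :: complex and p q :: "'a \<Rightarrow>\<^sub>0 'b"
  show "c *\<^sub>C (p + q) = c *\<^sub>C p + c *\<^sub>C q"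
    by (simp add: scaleC_poly_mapping_def distrib_left)
  show "(c + d) *\<^sub>C p = c *\<^sub>C p + d *\<^sub>C p"
    by (simp add: scaleC_poly_mapping_def scaleC_add_left single_add distrib_right)
  show "c *\<^sub>C d *\<^sub>C p = (c * d) *\<^sub>C p"
    by (simp add: scaleC_poly_mapping_def mult.assoc[symmetric] mult_single mult_scaleC_left
        scaleC_scaleC)
  show "1 *\<^sub>C p = p"
    by (simp add: scaleC_poly_mapping_def scaleC_one)
  show "(c *\<^sub>C p) * q = c *\<^sub>C (p * q)"
    by (simp add: scaleC_poly_mapping_def mult.assoc)
  have "p * Poly_Mapping.single 0 (c *\<^sub>C 1) = Poly_Mapping.single 0 (c *\<^sub>C 1) * p"
  proof (induction p rule: update_induct)
    case const
    then show ?case by simp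
  next
    case (update f a b)
    have *: "Poly_Mapping.update a b f = f + Poly_Mapping.single a b"
      using update by (intro poly_mapping_eqI)
        (auto simp: lookup_update lookup_add lookup_single when_def in_keys_iff)
    show ?case
      by (simp add: * distrib_left distrib_right update mult_single mult_scaleC_left mult_scaleC_right)
  qed
  then show "p * c *\<^sub>C q = c *\<^sub>C (p * q)"
    by (simp add: scaleC_poly_mapping_def mult.assoc[symmetric])
qed

end

abbreviation monomial :: "'a list \<Rightarrow> 'a word \<Rightarrow>\<^sub>0 complex"
  where "monomial xs \<equiv> Poly_Mapping.single (Word xs) 1"

definition multilinear_relations :: "('a::complex_algebra_1 word \<Rightarrow>\<^sub>0 complex) set"
  where "multilinear_relations =
    {monomial (us @ (a + b) # vs) - monomial (us @ a # vs) - monomial (us @ b # vs) | us a b vs. True} \<union>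
    {monomial (us @ (c *\<^sub>C a) # vs) - c *\<^sub>C monomial (us @ a # vs) | us c a vs. True}"

definition multilinear :: "('a::complex_algebra_1 list \<Rightarrow> complex) \<Rightarrow> bool"
  where "multilinear F \<longleftrightarrow>
    (\<forall>us a b vs. F (us @ (a + b) # vs) = F (us @ a # vs) + F (us @ b # vs)) \<and>
    (\<forall>us c a vs. F (us @ (c *\<^sub>C a) # vs) = c * F (us @ a # vs))"

lemma scaleC_single: "c *\<^sub>C Poly_Mapping.single w z = Poly_Mapping.single w (c * z)"
  for z :: complex
  by (simp add: scaleC_poly_mapping_def mult_single scaleC_complex_def)

lemma poly_mapping_in_cspan:
  fixes p :: "'a word \<Rightarrow>\<^sub>0 complex"
  shows "p \<in> cspan (range monomial)"
proof (induction p rule: update_induct)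
  case const
  then show ?case by (rule complex_vector.span_zero)
next
  case (update f a b)
  have "Poly_Mapping.update a b f = f + b *\<^sub>C monomial (letters a)"
    using update by (intro poly_mapping_eqI)
      (auto simp: scaleC_single lookup_update lookup_add lookup_single when_def in_keys_iff)
  then show ?case
    using update
    by (metis complex_vector.span_add complex_vector.span_scale complex_vector.span_base rangeI)
qed

lemma multilinear_iff_clinear:
  "multilinear F \<longleftrightarrow> (\<forall>us vs. clinear (\<lambda>x. F (us @ x # vs)))"
  by (auto simp: multilinear_def clinear_iff)

lemma relations_ideal_left:
  assumes "r \<in> cspan multilinear_relations"
  shows "p * r \<in> cspan multilinear_relations"
proof -
  have 1: "monomial ws * r \<in> multilinear_relations" if "r \<in> multilinear_relations" for ws and r :: "'a word \<Rightarrow>\<^sub>0 complex"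
    using that unfolding multilinear_relations_def
  proof (elim UnE CollectE exE conjE, goal_cases)
    case (1 us a b vs)
    then have "monomial ws * r =
        monomial ((ws @ us) @ (a + b) # vs) - monomial ((ws @ us) @ a # vs) - monomial ((ws @ us) @ b # vs)"
      by (simp add: right_diff_distrib mult_single plus_word_def)
    then show ?case by blast
  next
    case (2 us c a vs)
    then have "monomial ws * r =
        monomial ((ws @ us) @ (c *\<^sub>C a) # vs) - c *\<^sub>C monomial ((ws @ us) @ a # vs)"
      by (simp add: right_diff_distrib mult_single plus_word_def mult_scaleC_right)
    then show ?case by blast
  qed
  have 2: "monomial ws * r \<in> cspan multilinear_relations" for ws
    using assms
  proof (induction r rule: complex_vector.span_induct_alt)
    case base
    then show ?case by (simp add: complex_vector.span_zero)
  next
    case (step c x y)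
    then show ?case
      by (auto simp: distrib_left mult_scaleC_right
          intro!: complex_vector.span_add complex_vector.span_scale complex_vector.span_base[OF 1])
  qed
  show ?thesis
    using poly_mapping_in_cspan[of p]
  proof (induction p rule: complex_vector.span_induct_alt)
    case base
    then show ?case by (simp add: complex_vector.span_zero)
  next
    case (step c x y)
    then show ?case
      by (auto simp: distrib_right mult_scaleC_left 2
          intro!: complex_vector.span_add complex_vector.span_scale)
  qed
qed

lemma relations_ideal_right:
  assumes "r \<in> cspan multilinear_relations"
  shows "r * p \<in> cspan multilinear_relations"
proof -
  have 1: "r * monomial ws \<in> multilinear_relations" if "r \<in> multilinear_relations" for ws and r :: "'a word \<Rightarrow>\<^sub>0 complex"
    using that unfolding multilinear_relations_def
  proof (elim UnE CollectE exE conjE, goal_cases)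
    case (1 us a b vs)
    then have "r * monomial ws =
        monomial (us @ (a + b) # (vs @ ws)) - monomial (us @ a # (vs @ ws)) - monomial (us @ b # (vs @ ws))"
      by (simp add: left_diff_distrib mult_single plus_word_def)
    then show ?case by blast
  next
    case (2 us c a vs)
    then have "r * monomial ws =
        monomial (us @ (c *\<^sub>C a) # (vs @ ws)) - c *\<^sub>C monomial (us @ a # (vs @ ws))"
      by (simp add: left_diff_distrib mult_single plus_word_def mult_scaleC_left)
    then show ?case by blast
  qed
  have 2: "r * monomial ws \<in> cspan multilinear_relations" for ws
    using assms
  proof (induction r rule: complex_vector.span_induct_alt)
    case base
    then show ?case by (simp add: complex_vector.span_zero)
  next
    case (step c x y)
    then show ?case
      by (auto simp: distrib_right mult_scaleC_left
          intro!: complex_vector.span_add complex_vector.span_scale complex_vector.span_base[OF 1])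
  qed
  show ?thesis
    using poly_mapping_in_cspan[of p]
  proof (induction p rule: complex_vector.span_induct_alt)
    case base
    then show ?case by (simp add: complex_vector.span_zero)
  next
    case (step c x y)
    then show ?case
      by (auto simp: distrib_left mult_scaleC_right 2
          intro!: complex_vector.span_add complex_vector.span_scale)
  qed
qed

definition free_lift :: "('a list \<Rightarrow> complex) \<Rightarrow> ('a word \<Rightarrow>\<^sub>0 complex) \<Rightarrow> complex"
  where "free_lift F p = (\<Sum>w\<in>Poly_Mapping.keys p. Poly_Mapping.lookup p w * F (letters w))"

lemma free_lift_superset:
  assumes "finite K" "Poly_Mapping.keys p \<subseteq> K"
  shows "free_lift F p = (\<Sum>w\<in>K. Poly_Mapping.lookup p w * F (letters w))"
  unfolding free_lift_def using assms by (intro sum.mono_neutral_left) (auto simp: in_keys_iff)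

lemma free_lift_monomial: "free_lift F (monomial xs) = F xs"
  by (simp add: free_lift_def)

lemma lookup_scaleC: "Poly_Mapping.lookup (c *\<^sub>C p) w = c * Poly_Mapping.lookup p w"
  for p :: "'a::monoid_add \<Rightarrow>\<^sub>0 complex"
  by (simp add: scaleC_poly_mapping_def mult_map_scale_conv_mult[symmetric] map.rep_eq
      scaleC_complex_def when_def)

lemma free_lift_add: "free_lift F (p + q) = free_lift F p + free_lift F q"
  using keys_add[of p q]
  by (simp add: free_lift_superset[of "Poly_Mapping.keys p \<union> Poly_Mapping.keys q"] lookup_add
      distrib_right sum.distrib)

lemma free_lift_scaleC: "free_lift F (c *\<^sub>C p) = c * free_lift F p"
proof -
  have "Poly_Mapping.keys (c *\<^sub>C p) \<subseteq> Poly_Mapping.keys p"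
    by (auto simp: in_keys_iff lookup_scaleC)
  then show ?thesis
    by (simp add: free_lift_superset[of "Poly_Mapping.keys p"] lookup_scaleC sum_distrib_left mult.assoc)
qed

lemma free_lift_diff: "free_lift F (p - q) = free_lift F p - free_lift F q"
  using free_lift_add[of F "p - q" q] by simp

lemma free_lift_relations:
  assumes "multilinear F" "r \<in> cspan multilinear_relations"
  shows "free_lift F r = 0"
  using assms(2)
proof (induction r rule: complex_vector.span_induct_alt)
  case base
  then show ?case by (simp add: free_lift_def)
next
  case (step c x y)
  from step(1) assms(1) have "free_lift F x = 0"
    by (auto simp: multilinear_relations_def multilinear_def free_lift_diff free_lift_scaleC
        free_lift_monomial)
  with step show ?case by (simp add: free_lift_add free_lift_scaleC)
qed

quotient_type (overloaded) 'a tensor_algebra = "'a::complex_algebra_1 word \<Rightarrow>\<^sub>0 complex"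
  / "\<lambda>p q. p - q \<in> cspan multilinear_relations"
proof (rule equivpI)
  let ?R = "\<lambda>p q :: 'a word \<Rightarrow>\<^sub>0 complex. p - q \<in> cspan multilinear_relations"
  show "reflp ?R"
    by (rule reflpI) (simp add: complex_vector.span_zero)
  show "symp ?R"
  proof (rule sympI)
    fix p q assume "?R p q"
    from complex_vector.span_neg[OF this] show "?R q p" by simp
  qed
  show "transp ?R"
  proof (rule transpI)
    fix p q r assume "?R p q" "?R q r"
    from complex_vector.span_add[OF this] show "?R p r" by simp
  qed
qed

instantiation tensor_algebra :: (complex_algebra_1) complex_algebra_1
begin

lift_definition zero_tensor_algebra :: "'a tensor_algebra" is 0 .
lift_definition one_tensor_algebra :: "'a tensor_algebra" is 1 .

lift_definition plus_tensor_algebra :: "'a tensor_algebra \<Rightarrow> 'a tensor_algebra \<Rightarrow> 'a tensor_algebra" is "(+)"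
  using complex_vector.span_add by (fastforce simp: algebra_simps)

lift_definition minus_tensor_algebra :: "'a tensor_algebra \<Rightarrow> 'a tensor_algebra \<Rightarrow> 'a tensor_algebra" is "(-)"
  using complex_vector.span_diff by (fastforce simp: algebra_simps)

lift_definition uminus_tensor_algebra :: "'a tensor_algebra \<Rightarrow> 'a tensor_algebra" is uminus
  using complex_vector.span_neg by fastforce

lift_definition times_tensor_algebra :: "'a tensor_algebra \<Rightarrow> 'a tensor_algebra \<Rightarrow> 'a tensor_algebra" is "(*)"
proof -
  fix p p' q q' :: "'a word \<Rightarrow>\<^sub>0 complex"
  assume "p - p' \<in> cspan multilinear_relations" "q - q' \<in> cspan multilinear_relations"
  then have "(p - p') * q + p' * (q - q') \<in> cspan multilinear_relations"
    by (intro complex_vector.span_add relations_ideal_left relations_ideal_right)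
  then show "p * q - p' * q' \<in> cspan multilinear_relations"
    by (simp add: algebra_simps)
qed

lift_definition scaleC_tensor_algebra :: "complex \<Rightarrow> 'a tensor_algebra \<Rightarrow> 'a tensor_algebra" is scaleC
  by (metis complex_vector.scale_right_diff_distrib complex_vector.span_scale)

instance
proof
  show "(0 :: 'a tensor_algebra) \<noteq> 1"
  proof (transfer, rule notI)
    assume *: "0 - (1 :: 'a word \<Rightarrow>\<^sub>0 complex) \<in> cspan multilinear_relations"
    have "multilinear (\<lambda>xs :: 'a list. if xs = [] then 1 else 0)"
      by (simp add: multilinear_def)
    from free_lift_relations[OF this *] show False
      using free_lift_monomial[of "\<lambda>xs :: 'a list. if xs = [] then 1 else 0" "[]"]
      by (simp add: free_lift_diff free_lift_def zero_word_def lookup_one)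
  qed
qed (transfer; simp add: algebra_simps complex_vector.span_zero scaleC_add_left scaleC_add_right
      scaleC_scaleC scaleC_one mult_scaleC_left mult_scaleC_right)+

end

lift_definition tensor :: "'a::complex_algebra_1 list \<Rightarrow> 'a tensor_algebra" is monomial .

lemma tensor_Nil: "tensor [] = 1"
  by transfer (simp add: zero_word_def[symmetric] complex_vector.span_zero)

lemma tensor_append: "tensor (xs @ ys) = tensor xs * tensor ys"
  by transfer (simp add: mult_single plus_word_def complex_vector.span_zero)

lemma tensor_add: "tensor (us @ (a + b) # vs) = tensor (us @ a # vs) + tensor (us @ b # vs)"
  by transfer (rule complex_vector.span_base, unfold multilinear_relations_def diff_diff_eq[symmetric], blast)

lemma tensor_scaleC: "tensor (us @ (c *\<^sub>C a) # vs) = c *\<^sub>C tensor (us @ a # vs)"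
  by transfer (rule complex_vector.span_base, unfold multilinear_relations_def, blast)

lemma cspan_tensor: "cspan (range tensor) = UNIV"
proof -
  have "t \<in> cspan (range tensor)" for t :: "'b::complex_algebra_1 tensor_algebra"
  proof -
    obtain p where t: "t = abs_tensor_algebra p"
      by (induction t rule: tensor_algebra.abs_induct) auto
    show ?thesis unfolding t using poly_mapping_in_cspan[of p]
    proof (induction p rule: complex_vector.span_induct_alt)
      case base
      then show ?case
        by (simp add: zero_tensor_algebra.abs_eq[symmetric] complex_vector.span_zero)
    next
      case (step c x y)
      then obtain xs where "x = monomial xs" by auto
      then have "abs_tensor_algebra (c *\<^sub>C x + y) = c *\<^sub>C tensor xs + abs_tensor_algebra y"
        by (simp add: plus_tensor_algebra.abs_eq scaleC_tensor_algebra.abs_eq tensor.abs_eq)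
      with step show ?case
        by (metis complex_vector.span_add complex_vector.span_scale complex_vector.span_base rangeI)
    qed
  qed
  then show ?thesis by blast
qed

text \<open>
  For a subalgebra \<open>S\<close>, its tensor algebra is realised inside the tensor algebra of the ambient
  algebra (over a field the canonical map is injective).
\<close>

definition tensor_subalgebra :: "'a::complex_algebra_1 set \<Rightarrow> 'a tensor_algebra set"
  where "tensor_subalgebra S = cspan {tensor xs | xs. set xs \<subseteq> S}"

text \<open>
  The linear functional on the tensor algebra with prescribed values on pure tensors; it exists
  and is unique as soon as these values depend multilinearly on the letters.
\<close>

definition tensor_lift :: "('a::complex_algebra_1 list \<Rightarrow> complex) \<Rightarrow> 'a tensor_algebra \<Rightarrow> complex"
  where "tensor_lift F = (THE f. clinear f \<and> (\<forall>xs. f (tensor xs) = F xs))"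

lemma tensor_lift_exists:
  assumes "multilinear F"
  shows "\<exists>f. clinear f \<and> (\<forall>xs. f (tensor xs) = F xs)"
proof -
  define f where "f t = free_lift F (rep_tensor_algebra t)" for t
  have eq: "free_lift F p = free_lift F q" if "p - q \<in> cspan multilinear_relations" for p q
    using free_lift_relations[OF assms that] by (simp add: free_lift_diff)
  have f: "f (abs_tensor_algebra p) = free_lift F p" for p
    unfolding f_def by (rule eq) (metis Quotient_rep_abs[OF Quotient_tensor_algebra]
        complex_vector.span_zero diff_self)
  have "f (x + y) = f x + f y" for x y
    by (induction x rule: tensor_algebra.abs_induct; induction y rule: tensor_algebra.abs_induct)
       (simp add: f plus_tensor_algebra.abs_eq free_lift_add)
  moreover have "f (c *\<^sub>C x) = c * f x" for c x
    by (induction x rule: tensor_algebra.abs_induct)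
       (simp add: f scaleC_tensor_algebra.abs_eq free_lift_scaleC)
  moreover have "f (tensor xs) = F xs" for xs
    by (simp add: tensor.abs_eq f free_lift_monomial)
  ultimately show ?thesis by (auto simp: clinear_iff)
qed

lemma clinear_eq_on_tensors:
  fixes f g :: "'a::complex_algebra_1 tensor_algebra \<Rightarrow> complex"
  assumes "clinear f" "clinear g" "\<And>xs. f (tensor xs) = g (tensor xs)"
  shows "f = g"
proof
  fix t :: "'a tensor_algebra"
  have f: "f (x + y) = f x + f y" "f (c *\<^sub>C x) = c * f x"
   and g: "g (x + y) = g x + g y" "g (c *\<^sub>C x) = c * g x" for x y c
    using assms(1,2) by (auto simp: clinear_iff)
  have "t \<in> cspan (range tensor)" by (simp add: cspan_tensor)
  then show "f t = g t"
  proof (induction t rule: complex_vector.span_induct_alt)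
    case base
    show ?case using f(2)[of 0 0] g(2)[of 0 0] by simp
  next
    case (step c x y)
    then show ?case using assms(3) by (auto simp: f g)
  qed
qed

lemma tensor_lift:
  assumes "multilinear F"
  shows "clinear (tensor_lift F)" "tensor_lift F (tensor xs) = F xs"
proof -
  have "\<exists>!f. clinear f \<and> (\<forall>xs. f (tensor xs) = F xs)"
    using tensor_lift_exists[OF assms] by (auto intro!: clinear_eq_on_tensors)
  from theI'[OF this] show "clinear (tensor_lift F)" "tensor_lift F (tensor xs) = F xs"
    unfolding tensor_lift_def by auto
qed

section \<open>Boolean cumulants and the two functionals on the tensor algebra\<close>

text \<open>An interval partition of a word is a factorisation into nonempty consecutive blocks.\<close>

definition interval_partitions :: "'a list \<Rightarrow> 'a list list set"
  where "interval_partitions xs = {bs. concat bs = xs \<and> [] \<notin> set bs}"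

text \<open>The moment-cumulant relation, solved for the summand of the one-block partition.\<close>

function boolean_cumulant :: "('a::complex_algebra_1 \<Rightarrow> complex) \<Rightarrow> 'a list \<Rightarrow> complex"
  where "boolean_cumulant \<psi> xs =
    \<psi> (prod_list xs) -
    (\<Sum>bs \<in> interval_partitions xs - {[xs]}. \<Prod>b\<leftarrow>bs. boolean_cumulant \<psi> b)"
  by pat_completeness auto
termination
proof (relation "measure (\<lambda>(\<psi>, xs). length xs)", simp)
  fix \<psi> :: "'a \<Rightarrow> complex" and xs b :: "'a list" and bs
  assume bs: "bs \<in> interval_partitions xs - {[xs]}" and b: "b \<in> set bs"
  then obtain us vs where "bs = us @ b # vs" by (auto dest: split_list)
  with bs show "((\<psi>, b), (\<psi>, xs)) \<in> measure (\<lambda>(\<psi>, xs). length xs)"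
    by (cases us; cases vs) (auto simp: interval_partitions_def)
qed

declare boolean_cumulant.simps [simp del]

lemma interval_partitions_Nil: "interval_partitions [] = {[]}"
proof -
  have "bs = []" if "concat bs = []" "[] \<notin> set bs" for bs :: "'a list list"
    using that by (cases bs) auto
  then show ?thesis by (auto simp: interval_partitions_def)
qed

lemma interval_partitions_first_block:
  assumes "xs \<noteq> []"
  shows "interval_partitions xs =
    (\<Union>k\<in>{1..length xs}. (#) (take k xs) ` interval_partitions (drop k xs))"
proof (rule set_eqI, rule iffI)
  fix bs assume bs: "bs \<in> interval_partitions xs"
  with assms obtain b bs' where "bs = b # bs'"
    by (cases bs) (auto simp: interval_partitions_def)
  with bs have "xs = b @ concat bs'" "b \<noteq> []" "[] \<notin> set bs'" "bs = b # bs'"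
    by (auto simp: interval_partitions_def)
  then show "bs \<in> (\<Union>k\<in>{1..length xs}. (#) (take k xs) ` interval_partitions (drop k xs))"
    by (auto intro!: bexI[of _ "length b"] simp: interval_partitions_def Suc_le_eq)
next
  fix bs assume "bs \<in> (\<Union>k\<in>{1..length xs}. (#) (take k xs) ` interval_partitions (drop k xs))"
  with assms show "bs \<in> interval_partitions xs"
    by (auto simp: interval_partitions_def)
qed

lemma finite_interval_partitions: "finite (interval_partitions xs)"
proof (induction xs rule: length_induct)
  case (1 xs)
  then show ?case
    by (cases "xs = []") (auto simp: interval_partitions_Nil interval_partitions_first_block)
qed

lemma moment_eq_sum_boolean_cumulants:
  assumes "\<psi> 1 = 1"
  shows "\<psi> (prod_list xs) = (\<Sum>bs\<in>interval_partitions xs. \<Prod>b\<leftarrow>bs. boolean_cumulant \<psi> b)"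
proof (cases "xs = []")
  case True
  with assms show ?thesis by (simp add: interval_partitions_Nil)
next
  case False
  then have "[xs] \<in> interval_partitions xs" by (simp add: interval_partitions_def)
  with sum.remove[OF finite_interval_partitions this, of "\<lambda>bs. \<Prod>b\<leftarrow>bs. boolean_cumulant \<psi> b"]
  show ?thesis by (simp add: boolean_cumulant.simps[of \<psi> xs])
qed

lemma boolean_cumulant_first_block:
  assumes "\<psi> 1 = 1" "xs \<noteq> []"
  shows "boolean_cumulant \<psi> xs = \<psi> (prod_list xs) -
    (\<Sum>k=1..<length xs. boolean_cumulant \<psi> (take k xs) * \<psi> (prod_list (drop k xs)))"
proof -
  have "\<psi> (prod_list xs) = (\<Sum>k=1..length xs. \<Sum>bs\<in>(#) (take k xs) ` interval_partitions (drop k xs).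
      \<Prod>b\<leftarrow>bs. boolean_cumulant \<psi> b)"
    unfolding moment_eq_sum_boolean_cumulants[of \<psi> xs, OF assms(1)]
      interval_partitions_first_block[OF assms(2)]
  proof (rule sum.UNION_disjoint)
    show "\<forall>i\<in>{1..length xs}. \<forall>j\<in>{1..length xs}. i \<noteq> j \<longrightarrow>
       (#) (take i xs) ` interval_partitions (drop i xs) \<inter>
       (#) (take j xs) ` interval_partitions (drop j xs) = {}"
    proof (intro ballI impI)
      fix i j assume "i \<in> {1..length xs}" "j \<in> {1..length xs}" "i \<noteq> j"
      then have "length (take i xs) \<noteq> length (take j xs)" by auto
      then have "take i xs \<noteq> take j xs" by metis
      then show "(#) (take i xs) ` interval_partitions (drop i xs) \<inter>
         (#) (take j xs) ` interval_partitions (drop j xs) = {}" by auto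
    qed
  qed (auto simp: finite_interval_partitions)
  also have "\<dots> = (\<Sum>k=1..length xs. boolean_cumulant \<psi> (take k xs) * \<psi> (prod_list (drop k xs)))"
    by (intro sum.cong refl)
       (simp add: sum.reindex sum_distrib_left moment_eq_sum_boolean_cumulants[of \<psi>, OF assms(1)])
  also have "{1..length xs} = insert (length xs) {1..<length xs}"
    using assms(2) by (auto simp: Suc_le_eq)
  finally show ?thesis using assms(1) by simp
qed

lemma clinear_diff: "clinear f \<Longrightarrow> clinear g \<Longrightarrow> clinear (\<lambda>x. f x - g x)"
  by (simp add: clinear_iff algebra_simps)

lemma clinear_mult_left: "clinear f \<Longrightarrow> clinear (\<lambda>x. c * f x)"
  by (simp add: clinear_iff algebra_simps)

lemma clinear_mult_right: "clinear f \<Longrightarrow> clinear (\<lambda>x. f x * c)"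
  by (simp add: clinear_iff algebra_simps)

lemma clinear_sum: "(\<And>i. i \<in> S \<Longrightarrow> clinear (f i)) \<Longrightarrow> clinear (\<lambda>x. \<Sum>i\<in>S. f i x)"
  by (simp add: clinear_iff sum.distrib sum_distrib_left)

lemma multilinear_moment:
  assumes "clinear \<psi>"
  shows "multilinear (\<lambda>xs. \<psi> (prod_list xs))"
  using assms by (simp add: multilinear_def clinear_iff algebra_simps mult_scaleC_left mult_scaleC_right)

lemma multilinear_boolean_cumulant:
  assumes "unital_functional \<psi>"
  shows "multilinear (boolean_cumulant \<psi>)"
proof -
  have one: "\<psi> 1 = 1" and mom: "clinear (\<lambda>x. \<psi> (prod_list (us @ x # vs)))" for us vs
    using assms multilinear_moment[of \<psi>]
    by (auto simp: unital_functional_def multilinear_iff_clinear simp del: prod_list.append)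
  have "clinear (\<lambda>x. boolean_cumulant \<psi> (us @ x # vs))" for us vs
  proof (induction "length us + length vs" arbitrary: us vs rule: less_induct)
    case less
    have "clinear (\<lambda>x. boolean_cumulant \<psi> (take k (us @ x # vs)) * \<psi> (prod_list (drop k (us @ x # vs))))"
      if k: "k \<in> {1..<Suc (length us + length vs)}" for k
    proof (cases "k \<le> length us")
      case True
      then show ?thesis using mom[of "drop k us" vs]
        by (auto intro!: clinear_mult_left simp del: prod_list.append)
    next
      case False
      then obtain d where d: "k = Suc (length us + d)"
        by (metis add_Suc_right less_imp_Suc_add not_le)
      have "clinear (\<lambda>x. boolean_cumulant \<psi> (us @ x # take d vs))"
        using k d by (intro less) auto
      then show ?thesis unfolding d
        by (auto intro!: clinear_mult_right)
    qed
    then have "clinear (\<lambda>x. \<psi> (prod_list (us @ x # vs)) - (\<Sum>k=1..<Suc (length us + length vs).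
        boolean_cumulant \<psi> (take k (us @ x # vs)) * \<psi> (prod_list (drop k (us @ x # vs)))))"
      by (intro clinear_diff clinear_sum mom)
    moreover have "boolean_cumulant \<psi> (us @ x # vs) =
        \<psi> (prod_list (us @ x # vs)) - (\<Sum>k=1..<Suc (length us + length vs).
        boolean_cumulant \<psi> (take k (us @ x # vs)) * \<psi> (prod_list (drop k (us @ x # vs))))" for x
      using boolean_cumulant_first_block[of \<psi> "us @ x # vs", OF one] by simp
    ultimately show ?case by presburger
  qed
  then show ?thesis by (simp add: multilinear_iff_clinear)
qed

definition tensor_extension :: "('a::complex_algebra_1 \<Rightarrow> complex) \<Rightarrow> 'a tensor_algebra \<Rightarrow> complex"
  where "tensor_extension \<psi> = tensor_lift (\<lambda>xs. \<psi> (prod_list xs))"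

lemma tensor_extension_tensor:
  assumes "clinear \<psi>"
  shows "clinear (tensor_extension \<psi>)" "tensor_extension \<psi> (tensor xs) = \<psi> (prod_list xs)"
  unfolding tensor_extension_def by (rule tensor_lift[OF multilinear_moment[OF assms]])+

text \<open>
  Letters are indexed from \<open>0\<close>, so \<open>is\<close> ranges over the strictly increasing sequences of length \<open>l\<close>
  in \<open>{0..<n}\<close>; appending \<open>hd is + n\<close> realises the cyclic convention for the
  index following the last one, and letters are then read modulo \<open>n\<close>.
\<close>

definition cyclic_cumulant_sum :: "('a::complex_algebra_1 \<Rightarrow> complex) \<Rightarrow> 'a list \<Rightarrow> complex"
  where "cyclic_cumulant_sum \<psi> xs = (let n = length xs in
    \<Sum>l=1..n. \<Sum>is | length is = l \<and> sorted_wrt (<) is \<and> set is \<subseteq> {0..<n}.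
      \<Prod>k<l. boolean_cumulant \<psi>
        (map (\<lambda>m. xs ! (m mod n)) [(is @ [hd is + n]) ! k ..< (is @ [hd is + n]) ! Suc k]))"

lemma multilinear_cyclic_cumulant_sum:
  assumes "unital_functional \<psi>"
  shows "multilinear (\<lambda>xs. if xs = [] then 1 else cyclic_cumulant_sum \<psi> xs)"
proof -
  have beta: "clinear (\<lambda>x. boolean_cumulant \<psi> (us @ x # vs))" for us vs
    using multilinear_boolean_cumulant[OF assms] by (simp add: multilinear_iff_clinear)
  have "clinear (\<lambda>x. cyclic_cumulant_sum \<psi> (us @ x # vs))" for us vs
  proof -
    define n p where "n = Suc (length us + length vs)" and "p = length us"
    have "clinear (\<lambda>x. \<Prod>k<l. boolean_cumulant \<psi> (map (\<lambda>m. (us @ x # vs) ! (m mod n))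
        [(is @ [hd is + n]) ! k ..< (is @ [hd is + n]) ! Suc k]))"
      if l: "l \<in> {1..n}" "length is = l" "sorted_wrt (<) is" "set is \<subseteq> {0..<n}" for l "is"
    proof -
      define js where "js = is @ [hd is + n]"
      define q where "q = (if hd is \<le> p then p else p + n)"
      have ne: "is \<noteq> []" using l by auto
      then have hd: "hd is < n" using l(4) by (cases "is") auto
      have len: "length js = Suc l" using l by (simp add: js_def)
      have js0: "js ! 0 = hd is" using ne by (simp add: js_def hd_conv_nth nth_append)
      have jsl: "js ! l = hd is + n" using l by (simp add: js_def nth_append)
      have "sorted_wrt (<) js" using l hd ne by (force simp: js_def sorted_wrt_append)
      then have mono: "js ! i \<le> js ! j" if "i \<le> j" "j \<le> l" for i j
        using that len by (metis le_eq_less_or_eq less_Suc_eq_le sorted_wrt_nth_less)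
      have p: "p < n" by (simp add: n_def p_def)
      have q: "js ! 0 \<le> q" "q < js ! l" "q mod n = p"
        using hd p unfolding js0 jsl by (auto simp: q_def)
      define k0 where "k0 = (LEAST k. q < js ! Suc k)"
      have l': "Suc (l - 1) = l" using l by auto
      have "q < js ! Suc (l - 1)" using q l' by simp
      then have k0: "q < js ! Suc k0" "k0 \<le> l - 1"
        unfolding k0_def by (rule LeastI, rule Least_le)
      have k0l: "k0 < l" using k0 l' by linarith
      have k0': "js ! k0 \<le> q"
      proof (cases k0)
        case 0
        then show ?thesis using q by simp
      next
        case (Suc m)
        then show ?thesis using not_less_Least[of m "\<lambda>k. q < js ! Suc k"] by (simp add: k0_def)
      qed
      have uniq: "(us @ x # vs) ! (m mod n) = (us @ 0 # vs) ! (m mod n)"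
        if "js ! 0 \<le> m" "m < js ! l" "m \<noteq> q" for x m
      proof -
        have "m mod n \<noteq> p"
        proof
          assume *: "m mod n = p"
          have "m < n \<or> (n \<le> m \<and> m - n < n)" using that(2) hd unfolding jsl by linarith
          then have "m = p \<or> m = p + n" using *
            by (metis le_add_diff_inverse2 mod_add_self2 mod_less)
          then show False using that hd p unfolding js0 jsl q_def by (auto split: if_splits)
        qed
        then show ?thesis by (auto simp: nth_append nth_Cons p_def split: nat.split)
      qed
      define B where "B x k = boolean_cumulant \<psi> (map (\<lambda>m. (us @ x # vs) ! (m mod n)) [js ! k ..< js ! Suc k])" for x k
      have "B x k = B 0 k" if "k < l" "k \<noteq> k0" for x k
      proof -
        have "m \<noteq> q \<and> js ! 0 \<le> m \<and> m < js ! l" if m: "m \<in> {js ! k ..< js ! Suc k}" for m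
        proof -
          have "m \<noteq> q"
          proof (cases "k < k0")
            case True
            then have "js ! Suc k \<le> js ! k0" using k0l by (intro mono) auto
            with m k0' show ?thesis by auto
          next
            case False
            then have "js ! Suc k0 \<le> js ! k" using that \<open>k < l\<close> \<open>k \<noteq> k0\<close> by (intro mono) auto
            with m k0 show ?thesis by auto
          qed
          moreover have "js ! 0 \<le> js ! k" "js ! Suc k \<le> js ! l" using \<open>k < l\<close> by (auto intro!: mono)
          ultimately show ?thesis using m by auto
        qed
        then show ?thesis unfolding B_def
          by (intro arg_cong[where f = "boolean_cumulant \<psi>"] map_cong refl uniq) auto
      qed
      moreover have "(\<Prod>k<l. B x k) = B x k0 * (\<Prod>k\<in>{..<l} - {k0}. B x k)" for x
        using k0l by (intro prod.remove) auto
      ultimately have prod: "(\<Prod>k<l. B x k) = B x k0 * (\<Prod>k\<in>{..<l} - {k0}. B 0 k)" for x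
        by (metis (no_types, lifting) DiffE insertI1 lessThan_iff prod.cong singletonI)
      have block: "[js ! k0 ..< js ! Suc k0] = [js ! k0 ..< q] @ q # [Suc q ..< js ! Suc k0]"
        using upt_add_eq_append[of "js ! k0" q "js ! Suc k0 - q"] k0 k0'
        by (simp add: upt_conv_Cons)
      have ends: "js ! 0 \<le> js ! k0" "js ! Suc k0 \<le> js ! l" using k0l by (auto intro!: mono)
      have left: "map (\<lambda>m. (us @ x # vs) ! (m mod n)) [js ! k0 ..< q] =
          map (\<lambda>m. (us @ 0 # vs) ! (m mod n)) [js ! k0 ..< q]"
        and right: "map (\<lambda>m. (us @ x # vs) ! (m mod n)) [Suc q ..< js ! Suc k0] =
          map (\<lambda>m. (us @ 0 # vs) ! (m mod n)) [Suc q ..< js ! Suc k0]" for x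
        using ends k0 k0' q by (auto intro!: uniq)
      have "B x k0 = boolean_cumulant \<psi>
          (map (\<lambda>m. (us @ 0 # vs) ! (m mod n)) [js ! k0 ..< q] @ x #
           map (\<lambda>m. (us @ 0 # vs) ! (m mod n)) [Suc q ..< js ! Suc k0])" for x
        unfolding B_def block map_append list.map(2) left[of x] right[of x] using q(3) by (simp add: p_def)
      then have "clinear (\<lambda>x. B x k0)" using beta by simp
      then have "clinear (\<lambda>x. \<Prod>k<l. B x k)" unfolding prod by (rule clinear_mult_right)
      then show ?thesis by (simp add: B_def js_def)
    qed
    moreover have "length (us @ x # vs) = n" for x
      by (simp add: n_def)
    ultimately show ?thesis
      by (auto simp only: cyclic_cumulant_sum_def Let_def mem_Collect_eq intro!: clinear_sum)
  qed
  then show ?thesis by (simp add: multilinear_iff_clinear)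
qed

definition cyclic_functional :: "('a::complex_algebra_1 \<Rightarrow> complex) \<Rightarrow> 'a tensor_algebra \<Rightarrow> complex"
  where "cyclic_functional \<psi> =
    tensor_lift (\<lambda>xs. if xs = [] then 1 else cyclic_cumulant_sum \<psi> xs)"

lemma cyclic_functional_tensor:
  assumes "unital_functional \<psi>"
  shows "clinear (cyclic_functional \<psi>)"
    and "cyclic_functional \<psi> 1 = 1"
    and "xs \<noteq> [] \<Longrightarrow> cyclic_functional \<psi> (tensor xs) = cyclic_cumulant_sum \<psi> xs"
  using tensor_lift[OF multilinear_cyclic_cumulant_sum[OF assms]]
  by (simp_all add: cyclic_functional_def tensor_Nil[symmetric])

end

theory Submission
  imports Defs
begin

text \<open>
  Let \<open>P v = \<psi>(v) 1\<close>, a rank one projection of the algebra \<open>\<A>\<close>, let \<open>L\<close> be the action of the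
  tensor algebra on \<open>\<A>\<close> by left multiplications, and let \<open>M\<close> be its compression,
  \<open>M(a\<^sub>1 \<otimes> \<dots> \<otimes> a\<^sub>n) = (1 - P) a\<^sub>1 (1 - P) \<dots> a\<^sub>n (1 - P)\<close>. The operator \<open>D = L - M\<close> has finite rank,
  the Boolean cumulants are \<open>\<beta>(a\<^sub>1, \<dots>, a\<^sub>n) = \<psi>(a\<^sub>1 (1 - P) a\<^sub>2 \<dots> (1 - P) a\<^sub>n)\<close>, and \<open>[\<psi>](t)\<close> is
  the trace of \<open>D(t)\<close>. Since \<open>D(s t) = L(s) D(t) + D(s) M(t)\<close>, the value \<open>[\<psi>](t\<^sub>1 \<dots> t\<^sub>n)\<close> is the
  sum over \<open>k\<close> of the traces of \<open>D(t\<^sub>k) M(t\<^sub>k\<^sub>+\<^sub>1 \<dots> t\<^sub>n) L(t\<^sub>1 \<dots> t\<^sub>k\<^sub>-\<^sub>1)\<close>. For \<open>t\<^sub>k\<close> over a subalgebra \<open>S\<close>, the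
  operator \<open>D(t\<^sub>k)\<close> has range in \<open>S\<close> and kills every \<open>v\<close> with \<open>\<psi>(S v) = 0\<close>. For centred
  cyclically alternating \<open>t\<^sub>1, \<dots>, t\<^sub>n\<close>, freeness shows that the operator following \<open>D(t\<^sub>k)\<close> maps \<open>S\<close>
  into such vectors: \<open>M\<close> acts like \<open>L\<close> on the alternating products that occur, and \<open>M\<close> kills \<open>1\<close>.
\<close>

section \<open>Chains of cut positions\<close>

lemma sum_atMost_split_first:
  fixes f :: "nat \<Rightarrow> 'b::comm_monoid_add"
  shows "(\<Sum>l\<le>n. f l) = f 0 + (\<Sum>l=1..n. f l)"
  by (simp add: atMost_atLeast0 sum.atLeast_Suc_atMost)

text \<open>The recursion peels off the first pair, to match inductions on the first block of a
  partition. The indexed product occurring in \<open>cyclic_cumulant_sum\<close> is recovered by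
  \<open>path_weight_eq_prod\<close>.\<close>

fun path_weight :: "(nat \<Rightarrow> nat \<Rightarrow> complex) \<Rightarrow> nat list \<Rightarrow> complex"
  where
    "path_weight f (i # j # js) = f i j * path_weight f (j # js)"
  | "path_weight f _ = 1"

lemma path_weight_Cons: "is \<noteq> [] \<Longrightarrow> path_weight f (i # is) = f i (hd is) * path_weight f is"
  by (cases "is") auto

lemma path_weight_snoc:
  "is \<noteq> [] \<Longrightarrow> path_weight f (is @ [m]) = path_weight f is * f (last is) m"
  by (induction f "is" rule: path_weight.induct) auto

lemma path_weight_eq_prod:
  "path_weight f (is @ [m]) = (\<Prod>k<length is. f ((is @ [m]) ! k) ((is @ [m]) ! Suc k))"
  by (induction "is")
     (auto simp: path_weight_Cons prod.lessThan_Suc_shift hd_conv_nth simp del: prod.lessThan_Suc)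

text \<open>An interval partition of the positions from \<open>k\<close> to \<open>l - 1\<close>,
  encoded by its cuts with both ends included. The empty partition, for \<open>k = l\<close>, is the
  chain with one element.\<close>

definition cut_chains :: "nat \<Rightarrow> nat \<Rightarrow> nat list set"
  where "cut_chains k l = {is. is \<noteq> [] \<and> sorted_wrt (<) is \<and> hd is = k \<and> last is = l}"

lemma cut_chains_bounded:
  assumes "is \<in> cut_chains k l" "i \<in> set is"
  shows "k \<le> i \<and> i \<le> l"
proof -
  have *: "is \<noteq> []" "sorted is" "hd is = k" "last is = l"
    using assms(1) by (auto simp: cut_chains_def strict_sorted_iff)
  then have "i \<le> last is"
    using assms(2) by (cases "is" rule: rev_cases) (auto simp: sorted_append)
  moreover have "hd is \<le> i" using *(1,2) assms(2) by (cases "is") auto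
  ultimately show ?thesis using * by simp
qed

lemma cut_chains_le: "is \<in> cut_chains k l \<Longrightarrow> k \<le> l"
  using cut_chains_bounded[of "is" k l k] by (auto simp: cut_chains_def)

lemma cut_chains_refl: "cut_chains l l = {[l]}"
proof (intro set_eqI iffI)
  fix "is" assume c: "is \<in> cut_chains l l"
  then obtain js where js: "is = l # js" by (cases "is") (auto simp: cut_chains_def)
  have "js = []"
  proof (rule ccontr)
    assume "js \<noteq> []"
    then have "hd js \<in> set js" by simp
    with cut_chains_bounded[OF c, of "hd js"] c show False by (auto simp: js cut_chains_def)
  qed
  with js show "is \<in> {[l]}" by simp
qed (simp add: cut_chains_def)

text \<open>The second cut \<open>k'\<close> is the end of the first block; what follows it
  partitions the rest.\<close>

lemma cut_chains_less:
  assumes "k < l"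
  shows "cut_chains k l = (\<Union>k'\<in>{k<..l}. (#) k ` cut_chains k' l)"
proof (intro set_eqI iffI)
  fix "is" assume c: "is \<in> cut_chains k l"
  then obtain js where js: "is = k # js" "js \<noteq> []"
    using assms by (cases "is") (auto simp: cut_chains_def split: if_splits)
  then have "js \<in> cut_chains (hd js) l" "k < hd js" using c by (auto simp: cut_chains_def)
  moreover from this have "hd js \<le> l" by (auto dest: cut_chains_le)
  ultimately show "is \<in> (\<Union>k'\<in>{k<..l}. (#) k ` cut_chains k' l)" using js by auto
next
  fix "is" assume "is \<in> (\<Union>k'\<in>{k<..l}. (#) k ` cut_chains k' l)"
  then obtain k' js where js: "k < k'" "js \<in> cut_chains k' l" "is = k # js" by auto
  then have "\<forall>i\<in>set js. k < i" using cut_chains_bounded[OF js(2)] by fastforce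
  then show "is \<in> cut_chains k l" using js by (auto simp: cut_chains_def)
qed

lemma finite_cut_chains: "finite (cut_chains k l)"
proof (induction "l - k" arbitrary: k rule: less_induct)
  case less
  consider "k < l" | "k = l" | "l < k" by linarith
  then show ?case
  proof cases
    case 1
    then show ?thesis by (auto simp: cut_chains_less intro!: finite_imageI less)
  next
    case 2
    then show ?thesis by (simp add: cut_chains_refl)
  next
    case 3
    then have "cut_chains k l = {}" by (auto dest: cut_chains_le)
    then show ?thesis by simp
  qed
qed

section \<open>Linear extension from words\<close>

text \<open>Any complex algebra is allowed as target, so one notion covers both scalar maps and
  operators applied to a fixed vector. Working before the passage to the quotient spares a proof
  that each such map is multilinear in the letters.\<close>

definition linear_extension ::
    "('a list \<Rightarrow> 'b::complex_algebra_1) \<Rightarrow> ('a word \<Rightarrow>\<^sub>0 complex) \<Rightarrow> 'b"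
  where "linear_extension G p =
    (\<Sum>w\<in>Poly_Mapping.keys p. Poly_Mapping.lookup p w *\<^sub>C G (letters w))"

lemma linear_extension_superset:
  assumes "finite K" "Poly_Mapping.keys p \<subseteq> K"
  shows "linear_extension G p = (\<Sum>w\<in>K. Poly_Mapping.lookup p w *\<^sub>C G (letters w))"
  unfolding linear_extension_def using assms
  by (intro sum.mono_neutral_left) (auto simp: in_keys_iff)

lemma linear_extension_zero [simp]: "linear_extension G 0 = 0"
  by (simp add: linear_extension_def)

lemma linear_extension_monomial [simp]: "linear_extension G (monomial xs) = G xs"
  by (simp add: linear_extension_def scaleC_one)

lemma linear_extension_one [simp]: "linear_extension G 1 = G []"
  using linear_extension_monomial[of G "[]"] by (simp add: zero_word_def[symmetric])

lemma linear_extension_linear: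
  "linear_extension G (c *\<^sub>C p + q) = c *\<^sub>C linear_extension G p + linear_extension G q"
proof -
  let ?K = "Poly_Mapping.keys p \<union> Poly_Mapping.keys q"
  have "Poly_Mapping.keys (c *\<^sub>C p + q) \<subseteq> ?K"
    by (auto simp: in_keys_iff lookup_add lookup_scaleC)
  then show ?thesis
    by (simp add: linear_extension_superset[of ?K] lookup_add lookup_scaleC scaleC_add_left
        sum.distrib complex_vector.scale_sum_right scaleC_scaleC)
qed

lemma linear_extension_add:
  "linear_extension G p + linear_extension H p = linear_extension (\<lambda>xs. G xs + H xs) p"
  by (simp add: linear_extension_def scaleC_add_right sum.distrib)

definition word_span :: "'a list set \<Rightarrow> ('a word \<Rightarrow>\<^sub>0 complex) set"
  where "word_span W = cspan (monomial ` W)"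

lemma word_span_induct [consumes 1, case_names zero step]:
  assumes "p \<in> word_span W"
    and "Q 0"
    and "\<And>c xs p. xs \<in> W \<Longrightarrow> Q p \<Longrightarrow> Q (c *\<^sub>C monomial xs + p)"
  shows "Q p"
  using assms(1) unfolding word_span_def
  by (induction p rule: complex_vector.span_induct_alt) (auto intro: assms(2,3))

lemma word_span_UNIV: "p \<in> word_span UNIV"
  unfolding word_span_def by (rule poly_mapping_in_cspan)

lemma linear_extension_in_subspace:
  assumes "p \<in> word_span W" "module.subspace scaleC V" "\<And>xs. xs \<in> W \<Longrightarrow> G xs \<in> V"
  shows "linear_extension G p \<in> V"
  using assms(1)
  by (induction p rule: word_span_induct)
     (auto simp: linear_extension_linear
       intro: assms(3) complex_vector.subspace_add[OF assms(2)]
         complex_vector.subspace_scale[OF assms(2)] complex_vector.subspace_0[OF assms(2)])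

lemma linear_extension_cong:
  assumes "p \<in> word_span W" "\<And>xs. xs \<in> W \<Longrightarrow> G xs = H xs"
  shows "linear_extension G p = linear_extension H p"
  using assms(1)
  by (induction p rule: word_span_induct) (simp_all add: linear_extension_linear assms(2))

lemma linear_map_zero:
  fixes H :: "'a::complex_algebra_1 \<Rightarrow> 'b::complex_algebra_1"
  assumes "\<And>c u v. H (c *\<^sub>C u + v) = c *\<^sub>C H u + H v"
  shows "H 0 = 0"
  using assms[of "-1" 0 0] by (simp add: complex_vector.scale_minus_left scaleC_one)

lemma linear_extension_comp:
  assumes "\<And>c u v. H (c *\<^sub>C u + v) = c *\<^sub>C H u + H v"
  shows "linear_extension (\<lambda>xs. H (G xs)) p = H (linear_extension G p)"
  using word_span_UNIV[of p]
  by (induction p rule: word_span_induct)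
     (simp_all add: linear_extension_linear assms linear_map_zero[OF assms])

text \<open>Both sides are bilinear in \<open>p\<close> and \<open>q\<close>, and on monomials the
  product is concatenation.\<close>

lemma linear_extension_mult:
  "linear_extension G (p * q) = linear_extension (\<lambda>xs. linear_extension (\<lambda>ys. G (xs @ ys)) q) p"
proof -
  have 1: "linear_extension G (monomial xs * q) = linear_extension (\<lambda>ys. G (xs @ ys)) q" for xs
    using word_span_UNIV[of q]
    by (induction q rule: word_span_induct)
       (simp_all add: linear_extension_linear distrib_left mult_scaleC_right mult_single plus_word_def)
  show ?thesis
    using word_span_UNIV[of p]
    by (induction p rule: word_span_induct)
       (simp_all add: linear_extension_linear distrib_right mult_scaleC_left 1)
qed

lemma linear_extension_prod_list_mult:
  "linear_extension prod_list (p * q) = linear_extension prod_list p * linear_extension prod_list q"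
proof -
  have "linear_extension (\<lambda>ys. prod_list xs * prod_list ys) q =
      prod_list xs * linear_extension prod_list q" for xs :: "'a list"
    by (rule linear_extension_comp) (simp add: distrib_left mult_scaleC_right)
  moreover have "linear_extension (\<lambda>xs. prod_list xs * linear_extension prod_list q) p =
      linear_extension prod_list p * linear_extension prod_list q"
    by (rule linear_extension_comp) (simp add: distrib_right mult_scaleC_left)
  ultimately show ?thesis by (simp add: linear_extension_mult)
qed

lemma linear_extension_prod_list_prod_list:
  "linear_extension prod_list (prod_list ps) = prod_list (map (linear_extension prod_list) ps)"
  by (induction ps) (simp_all add: linear_extension_prod_list_mult)

lemma prod_list_closed:
  assumes "unital_subalgebra S" "set xs \<subseteq> S"
  shows "prod_list xs \<in> S"
  using assms(2) by (induction xs) (use assms(1) in \<open>auto simp: unital_subalgebra_def\<close>)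

lemma linear_extension_prod_list_closed:
  assumes "unital_subalgebra S" "p \<in> word_span (lists S)"
  shows "linear_extension prod_list p \<in> S"
  using assms(2)
  by (rule linear_extension_in_subspace)
     (use assms(1) in \<open>auto simp: unital_subalgebra_def intro!: prod_list_closed[OF assms(1)]\<close>)

section \<open>Passage from word polynomials to the tensor algebra\<close>

lemma clinear_abs_tensor_algebra:
  assumes "clinear f" "\<And>xs. f (tensor xs) = F xs"
  shows "f (abs_tensor_algebra p) = linear_extension F p"
  using word_span_UNIV[of p]
proof (induction p rule: word_span_induct)
  case zero
  have "f 0 = 0" using assms(1) unfolding clinear_iff by (metis add_cancel_right_right)
  then show ?case by (simp add: zero_tensor_algebra_def)
next
  case (step c xs p)
  have "abs_tensor_algebra (c *\<^sub>C monomial xs + p) = c *\<^sub>C tensor xs + abs_tensor_algebra p"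
    by (simp add: plus_tensor_algebra.abs_eq scaleC_tensor_algebra.abs_eq tensor.abs_eq)
  then show ?case
    using assms step by (simp add: linear_extension_linear clinear_iff scaleC_complex_def)
qed

text \<open>Choosing a representative whose letters all lie in \<open>S\<close> reduces claims about
  the subalgebra to words over \<open>S\<close>.\<close>

lemma tensor_subalgebra_representative:
  assumes "t \<in> tensor_subalgebra S"
  obtains p where "p \<in> word_span (lists S)" "t = abs_tensor_algebra p"
proof -
  have "\<exists>p \<in> word_span (lists S). t = abs_tensor_algebra p"
    using assms unfolding tensor_subalgebra_def
  proof (induction t rule: complex_vector.span_induct_alt)
    case base
    then show ?case
      by (intro bexI[of _ 0]) (simp_all add: zero_tensor_algebra_def word_span_def complex_vector.span_zero)
  next
    case (step c x y)
    then obtain xs p where xs: "x = tensor xs" "set xs \<subseteq> S"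
      and p: "p \<in> word_span (lists S)" "y = abs_tensor_algebra p" by auto
    have "c *\<^sub>C x + y = abs_tensor_algebra (c *\<^sub>C monomial xs + p)"
      by (simp add: xs p plus_tensor_algebra.abs_eq scaleC_tensor_algebra.abs_eq tensor.abs_eq)
    moreover have "c *\<^sub>C monomial xs + p \<in> word_span (lists S)"
      using p(1) complex_vector.span_base[of "monomial xs" "monomial ` lists S"] xs(2)
      unfolding word_span_def
      by (intro complex_vector.span_add complex_vector.span_scale) auto
    ultimately show ?case by blast
  qed
  then show thesis using that by blast
qed

lemma abs_tensor_algebra_prod_list:
  "abs_tensor_algebra (prod_list ps) = prod_list (map abs_tensor_algebra ps)"
  by (induction ps) (simp_all add: one_tensor_algebra_def times_tensor_algebra.abs_eq[symmetric])

lemma unital_subalgebra_tensor_subalgebra: "unital_subalgebra (tensor_subalgebra S)"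
  unfolding unital_subalgebra_def
proof (intro conjI ballI)
  show "1 \<in> tensor_subalgebra S"
    unfolding tensor_subalgebra_def tensor_Nil[symmetric]
    by (rule complex_vector.span_base) (auto intro: exI[of _ "[]"])
  show "module.subspace scaleC (tensor_subalgebra S)"
    unfolding tensor_subalgebra_def by (rule complex_vector.subspace_span)
  fix s t assume "s \<in> tensor_subalgebra S" "t \<in> tensor_subalgebra S"
  have words: "tensor xs * t \<in> tensor_subalgebra S" if "set xs \<subseteq> S" for xs
    using \<open>t \<in> tensor_subalgebra S\<close> unfolding tensor_subalgebra_def
  proof (induction t rule: complex_vector.span_induct_alt)
    case base
    then show ?case by (simp add: complex_vector.span_zero)
  next
    case (step c x y)
    then obtain ys where "x = tensor ys" "set ys \<subseteq> S" by auto
    then have "tensor xs * x \<in> {tensor xs |xs. set xs \<subseteq> S}"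
      using that by (auto simp: tensor_append[symmetric] intro!: exI[of _ "xs @ ys"])
    with step show ?case
      unfolding distrib_left mult_scaleC_right
      by (intro complex_vector.span_add complex_vector.span_scale
          complex_vector.span_base[of "tensor xs * x"])
  qed
  show "s * t \<in> tensor_subalgebra S"
    using \<open>s \<in> tensor_subalgebra S\<close> unfolding tensor_subalgebra_def
  proof (induction s rule: complex_vector.span_induct_alt)
    case base
    then show ?case by (simp add: complex_vector.span_zero)
  next
    case (step c x y)
    then show ?case using words
      by (auto simp: distrib_right mult_scaleC_left tensor_subalgebra_def
          intro!: complex_vector.span_add complex_vector.span_scale)
  qed
qed

section \<open>Alternating products\<close>

text \<open>Products grow on the left because operators act by left multiplication. The index
  remembers the algebra of the leftmost factor, which decides what may be prepended.\<close>

inductive alternating ::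
    "'i set \<Rightarrow> ('i \<Rightarrow> 'a::complex_algebra_1 set) \<Rightarrow> ('a \<Rightarrow> complex) \<Rightarrow> 'i \<Rightarrow> 'a \<Rightarrow> bool"
  for I A \<psi>
  where
    single: "i \<in> I \<Longrightarrow> a \<in> A i \<Longrightarrow> \<psi> a = 0 \<Longrightarrow> alternating I A \<psi> i a"
  | mult: "alternating I A \<psi> i w \<Longrightarrow> k \<in> I \<Longrightarrow> a \<in> A k \<Longrightarrow> \<psi> a = 0 \<Longrightarrow> k \<noteq> i \<Longrightarrow>
      alternating I A \<psi> k (a * w)"

lemma alternating_eq_prod_list:
  assumes "alternating I A \<psi> i w"
  shows "\<exists>n\<ge>1. \<exists>j a. w = prod_list (map a [0..<n]) \<and> j 0 = i \<and>
    (\<forall>k<n. j k \<in> I \<and> a k \<in> A (j k) \<and> \<psi> (a k) = 0) \<and>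
    (\<forall>k. Suc k < n \<longrightarrow> j k \<noteq> j (Suc k))"
  using assms
proof induction
  case (single i a)
  then show ?case
    by (intro exI[of _ "1::nat"] conjI exI[of _ "\<lambda>_. i"] exI[of _ "\<lambda>_. a"]) auto
next
  case (mult i w k a)
  then obtain n j b where n: "n \<ge> 1" and w: "w = prod_list (map b [0..<n])" "j 0 = i"
    and j: "\<forall>k<n. j k \<in> I \<and> b k \<in> A (j k) \<and> \<psi> (b k) = 0"
    "\<forall>k. Suc k < n \<longrightarrow> j k \<noteq> j (Suc k)" by blast
  have "map (case_nat a b) [0..<Suc n] = a # map b [0..<n]"
    by (simp add: upt_conv_Cons map_Suc_upt[symmetric] comp_def del: upt_Suc)
  then show ?case using n w j mult
    by (intro exI[of _ "Suc n"] conjI exI[of _ "case_nat k j"] exI[of _ "case_nat a b"])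
       (auto split: nat.split simp del: upt_Suc)
qed

lemma free_wrt_alternating:
  assumes "free_wrt I A \<psi>" "alternating I A \<psi> i w"
  shows "\<psi> w = 0"
  using alternating_eq_prod_list[OF assms(2)] assms(1) unfolding free_wrt_def by blast

section \<open>Boolean cumulants as compressed moments\<close>

text \<open>The projection \<open>1 - P\<close>.\<close>

definition center :: "('a::complex_algebra_1 \<Rightarrow> complex) \<Rightarrow> 'a \<Rightarrow> 'a"
  where "center \<psi> v = v - \<psi> v *\<^sub>C 1"

text \<open>The operator \<open>M\<close>, with \<open>1 - P\<close> on both sides of every
  letter.\<close>

primrec compress :: "('a::complex_algebra_1 \<Rightarrow> complex) \<Rightarrow> 'a list \<Rightarrow> 'a \<Rightarrow> 'a"
  where
    "compress \<psi> [] v = center \<psi> v"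
  | "compress \<psi> (x # xs) v = center \<psi> (x * compress \<psi> xs v)"

text \<open>The functional sending \<open>v\<close> to \<psi> of
  \<open>x\<^sub>1 (1 - P) x\<^sub>2 ... (1 - P) x\<^sub>n (1 - P) v\<close>: unlike in
  \<open>compress\<close>, the leftmost projection is missing and \<psi> is taken instead. These are
  the functionals in the rank one decomposition of \<open>D\<close>.\<close>

primrec vacuum_coeff :: "('a::complex_algebra_1 \<Rightarrow> complex) \<Rightarrow> 'a list \<Rightarrow> 'a \<Rightarrow> complex"
  where
    "vacuum_coeff \<psi> [] v = \<psi> v"
  | "vacuum_coeff \<psi> (x # xs) v = \<psi> (x * compress \<psi> xs v)"

text \<open>The trace of the finite rank operator \<open>X D(xs)\<close>.\<close>

primrec defect_trace ::
    "('a::complex_algebra_1 \<Rightarrow> complex) \<Rightarrow> 'a list \<Rightarrow> ('a \<Rightarrow> 'a) \<Rightarrow> complex"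
  where
    "defect_trace \<psi> [] X = \<psi> (X 1)"
  | "defect_trace \<psi> (x # xs) X =
      vacuum_coeff \<psi> (x # xs) (X 1) + defect_trace \<psi> xs (\<lambda>v. X (x * v))"

text \<open>The vectors that \<open>D\<close> kills for all words over \<open>S\<close>, as
  \<open>vacuum_coeff_annihilated\<close> shows when \<open>S\<close> is a unital
  subalgebra.\<close>

definition left_annihilated :: "('a::complex_algebra_1 \<Rightarrow> complex) \<Rightarrow> 'a set \<Rightarrow> 'a set"
  where "left_annihilated \<psi> S = {v. \<forall>a\<in>S. \<psi> (a * v) = 0}"

lemma left_annihilated_mult:
  assumes "unital_subalgebra S" "a \<in> S" "v \<in> left_annihilated \<psi> S"
  shows "a * v \<in> left_annihilated \<psi> S"
  using assms by (auto simp: left_annihilated_def unital_subalgebra_def mult.assoc[symmetric])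

section \<open>Calculus of the compression for a fixed unital functional\<close>

context
  fixes \<psi> :: "'a::complex_algebra_1 \<Rightarrow> complex"
  assumes unital: "unital_functional \<psi>"
begin

lemma psi_one: "\<psi> 1 = 1"
  and psi_add: "\<psi> (u + v) = \<psi> u + \<psi> v"
  and psi_scaleC: "\<psi> (c *\<^sub>C u) = c * \<psi> u"
  using unital by (auto simp: unital_functional_def clinear_iff)

lemma psi_diff: "\<psi> (u - v) = \<psi> u - \<psi> v"
  using psi_add[of "u - v" v] by simp

lemma psi_zero: "\<psi> 0 = 0"
  using psi_diff[of 0 0] by simp

lemma psi_sum: "\<psi> (sum f S) = (\<Sum>i\<in>S. \<psi> (f i))"
  by (induction S rule: infinite_finite_induct) (auto simp: psi_zero psi_add)

lemma psi_center: "\<psi> (center \<psi> v) = 0"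
  by (simp add: center_def psi_diff psi_scaleC psi_one)

lemma center_of_centred: "\<psi> v = 0 \<Longrightarrow> center \<psi> v = v"
  by (simp add: center_def)

lemma center_one: "center \<psi> 1 = 0"
  by (simp add: center_def psi_one scaleC_one)

lemma center_zero: "center \<psi> 0 = 0"
  by (simp add: center_of_centred psi_zero)

lemma center_linear: "center \<psi> (c *\<^sub>C u + v) = c *\<^sub>C center \<psi> u + center \<psi> v"
  by (simp add: center_def psi_add psi_scaleC scaleC_add_left scaleC_scaleC
      complex_vector.scale_right_diff_distrib)

lemma psi_compress: "\<psi> (compress \<psi> xs v) = 0"
  by (cases xs) (simp_all add: psi_center)

lemma compress_linear:
  "compress \<psi> xs (c *\<^sub>C u + v) = c *\<^sub>C compress \<psi> xs u + compress \<psi> xs v"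
  by (induction xs) (simp_all add: center_linear distrib_left mult_scaleC_right)

lemma compress_one: "compress \<psi> xs 1 = 0"
  by (induction xs) (simp_all add: center_one center_zero)

text \<open>The projections meeting at the junction merge, since \<open>1 - P\<close> fixes every
  vector in the kernel of \<psi>.\<close>

lemma compress_append: "compress \<psi> (xs @ ys) v = compress \<psi> xs (compress \<psi> ys v)"
  by (induction xs) (simp_all add: center_of_centred psi_compress)

lemma vacuum_coeff_linear:
  "vacuum_coeff \<psi> xs (c *\<^sub>C u + v) = c * vacuum_coeff \<psi> xs u + vacuum_coeff \<psi> xs v"
  by (cases xs) (simp_all add: compress_linear distrib_left mult_scaleC_right psi_add psi_scaleC)

lemma vacuum_coeff_zero: "vacuum_coeff \<psi> xs 0 = 0"
  using vacuum_coeff_linear[of xs "-1" 0 0] by simp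

lemma vacuum_coeff_sum:
  "vacuum_coeff \<psi> xs (\<Sum>i\<in>S. c i *\<^sub>C f i) = (\<Sum>i\<in>S. c i * vacuum_coeff \<psi> xs (f i))"
  by (induction S rule: infinite_finite_induct) (auto simp: vacuum_coeff_zero vacuum_coeff_linear)

lemma vacuum_coeff_one: "xs \<noteq> [] \<Longrightarrow> vacuum_coeff \<psi> xs 1 = 0"
  by (cases xs) (simp_all add: compress_one psi_zero)

text \<open>Expands the rightmost projection \<open>1 - P\<close>. Read backwards, it moves the last
  letter of the word into the argument.\<close>

lemma vacuum_coeff_snoc:
  "vacuum_coeff \<psi> (xs @ [y]) v = vacuum_coeff \<psi> xs (y * v) - \<psi> v * vacuum_coeff \<psi> xs y"
proof -
  have c: "y * center \<psi> v = (- \<psi> v) *\<^sub>C y + y * v"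
    by (simp add: center_def right_diff_distrib mult_scaleC_right)
  show ?thesis
  proof (cases xs)
    case Nil
    then show ?thesis by (simp only: append_Nil vacuum_coeff.simps compress.simps c psi_add psi_scaleC)
        (simp add: psi_add psi_scaleC)
  next
    case (Cons x xs')
    have "compress \<psi> (xs' @ [y]) v = compress \<psi> xs' (center \<psi> (y * center \<psi> v))"
      by (simp add: compress_append)
    \<comment> \<open>The empty compression is \<open>center \<psi>\<close>, so the rightmost
      \<open>1 - P\<close> of \<open>compress \<psi> xs'\<close> absorbs a further one.\<close>
    also have "\<dots> = compress \<psi> xs' (y * center \<psi> v)"
      using compress_append[of xs' "[]"] by simp
    finally show ?thesis using vacuum_coeff_linear[of xs "- \<psi> v" y "y * v"]
      by (simp add: Cons c)
  qed
qed

text \<open>The decomposition of \<open>D\<close> into rank one operators. Insert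
  \<open>P + (1 - P)\<close> before, between and after the letters and sort by the position
  \<open>l\<close> of the rightmost \<open>P\<close>: only \<open>1 - P\<close> stands to its right,
  while nothing is inserted to its left.\<close>

lemma left_mult_minus_compress:
  "prod_list xs * v - compress \<psi> xs v =
    (\<Sum>l\<le>length xs. vacuum_coeff \<psi> (drop l xs) v *\<^sub>C prod_list (take l xs))"
proof (induction xs)
  case Nil
  then show ?case by (simp add: center_def)
next
  case (Cons x xs)
  have "prod_list (x # xs) * v - compress \<psi> (x # xs) v =
      vacuum_coeff \<psi> (x # xs) v *\<^sub>C 1 + x * (prod_list xs * v - compress \<psi> xs v)"
    by (simp add: center_def algebra_simps)
  then show ?case
    unfolding Cons.IH
    by (simp del: vacuum_coeff.simps sum.atMost_Suc
        add: sum.atMost_Suc_shift sum_distrib_left mult_scaleC_right)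
qed

text \<open>The operator \<open>v \<mapsto> f(v) X(u)\<close> has trace \<open>f(X(u))\<close>,
  applied to each rank one summand of \<open>D\<close>.\<close>

lemma defect_trace_eq_sum:
  "defect_trace \<psi> xs X =
    (\<Sum>l\<le>length xs. vacuum_coeff \<psi> (drop l xs) (X (prod_list (take l xs))))"
  by (induction xs arbitrary: X)
     (simp_all del: vacuum_coeff.simps(2) sum.atMost_Suc add: sum.atMost_Suc_shift)

lemma defect_trace_linear:
  "defect_trace \<psi> xs (\<lambda>v. c *\<^sub>C X v + Y v) = c * defect_trace \<psi> xs X + defect_trace \<psi> xs Y"
  by (simp add: defect_trace_eq_sum vacuum_coeff_linear sum.distrib sum_distrib_left)

text \<open>This is \<open>D(s t) = L(s) D(t) + D(s) M(t)\<close> multiplied by \<open>X\<close>,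
  with \<open>M(t)\<close> moved to the front under the trace.\<close>

lemma defect_trace_append:
  "defect_trace \<psi> (xs @ ys) X =
    defect_trace \<psi> ys (\<lambda>v. X (prod_list xs * v)) + defect_trace \<psi> xs (\<lambda>v. compress \<psi> ys (X v))"
  by (induction xs arbitrary: X) (simp_all add: psi_compress compress_append mult.assoc)

text \<open>
  By \<open>defect_trace_append\<close>, the difference of the two sides is
  \<open>Tr(D(xs) D(ys)) - Tr(D(ys) D(xs))\<close>.
\<close>

lemma defect_trace_commute:
  "defect_trace \<psi> (xs @ ys) (\<lambda>v. v) = defect_trace \<psi> (ys @ xs) (\<lambda>v. v)"
proof -
  \<comment> \<open>Since \<open>L - M = D\<close>, this is the trace of \<open>D(xs) D(ys)\<close>;
    the double sum is symmetric under exchanging \<open>xs\<close> and \<open>ys\<close>.\<close>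
  have D: "defect_trace \<psi> ys (\<lambda>v. prod_list xs * v) - defect_trace \<psi> ys (compress \<psi> xs) =
     (\<Sum>k\<le>length ys. \<Sum>l\<le>length xs. vacuum_coeff \<psi> (drop l xs) (prod_list (take k ys)) *
        vacuum_coeff \<psi> (drop k ys) (prod_list (take l xs)))" for xs ys
  proof -
    have "defect_trace \<psi> ys (\<lambda>v. prod_list xs * v) =
      defect_trace \<psi> ys (\<lambda>v. (1::complex) *\<^sub>C compress \<psi> xs v + (prod_list xs * v - compress \<psi> xs v))"
      by (simp add: scaleC_one)
    also have "\<dots> = defect_trace \<psi> ys (compress \<psi> xs) +
        defect_trace \<psi> ys (\<lambda>v. prod_list xs * v - compress \<psi> xs v)"
      by (subst defect_trace_linear) simp
    finally show ?thesis
      by (simp add: left_mult_minus_compress defect_trace_eq_sum vacuum_coeff_sum)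
  qed
  have "defect_trace \<psi> ys (\<lambda>v. prod_list xs * v) - defect_trace \<psi> ys (compress \<psi> xs) =
      defect_trace \<psi> xs (\<lambda>v. prod_list ys * v) - defect_trace \<psi> xs (compress \<psi> ys)"
    unfolding D by (subst sum.swap) (simp add: mult.commute)
  then show ?thesis by (simp add: defect_trace_append algebra_simps)
qed

text \<open>Links the compression with the cumulants: only the first block, which contains all of
  \<open>ys\<close> and at least one letter of \<open>zs\<close>, is split off. The induction moves
  the last letter of \<open>ys\<close> to the front of \<open>zs\<close>.\<close>

lemma vacuum_coeff_prod_list:
  assumes "zs \<noteq> []"
  shows "vacuum_coeff \<psi> ys (prod_list zs) =
    (\<Sum>k=1..length zs. boolean_cumulant \<psi> (ys @ take k zs) * \<psi> (prod_list (drop k zs)))"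
  using assms
proof (induction ys arbitrary: zs rule: rev_induct)
  case Nil
  have "{1..length zs} = insert (length zs) {1..<length zs}"
    using Nil by (auto simp: Suc_le_eq)
  then show ?case
    using boolean_cumulant_first_block[of \<psi> zs, OF psi_one Nil] by (simp add: psi_one)
next
  case (snoc y ys)
  have "vacuum_coeff \<psi> (ys @ [y]) (prod_list zs) =
      vacuum_coeff \<psi> ys (prod_list (y # zs)) - \<psi> (prod_list zs) * vacuum_coeff \<psi> ys (prod_list [y])"
    by (simp add: vacuum_coeff_snoc)
  also have "\<dots> = (\<Sum>k=1..Suc (length zs). boolean_cumulant \<psi> (ys @ take k (y # zs)) *
        \<psi> (prod_list (drop k (y # zs)))) - \<psi> (prod_list zs) * boolean_cumulant \<psi> (ys @ [y])"
    by (subst (1 2) snoc.IH) (simp_all add: psi_one)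
  also have "\<dots> = (\<Sum>k=1..length zs. boolean_cumulant \<psi> ((ys @ [y]) @ take k zs) *
        \<psi> (prod_list (drop k zs)))"
    \<comment> \<open>The term \<open>k = 1\<close>, whose block ends exactly at \<open>y\<close>,
      cancels against the subtracted product.\<close>
    using sum.atLeast_Suc_atMost_Suc_shift[of "\<lambda>k. boolean_cumulant \<psi> (ys @ take k (y # zs)) *
        \<psi> (prod_list (drop k (y # zs)))" 0 "length zs"]
    by (simp add: sum.atLeast_Suc_atMost)
  finally show ?case .
qed

lemma vacuum_coeff_eq_boolean_cumulant:
  "vacuum_coeff \<psi> ys v = boolean_cumulant \<psi> (ys @ [v])"
  using vacuum_coeff_prod_list[of "[v]" ys] by (simp add: psi_one)

text \<open>The mirror image of \<open>boolean_cumulant_first_block\<close>. It follows by applying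
  \<psi> to the rank one decomposition of \<open>D\<close>, as \<psi> vanishes on the range of
  \<open>compress\<close>.\<close>

lemma moment_last_block:
  assumes "xs \<noteq> []"
  shows "\<psi> (prod_list xs) =
    (\<Sum>l<length xs. boolean_cumulant \<psi> (drop l xs) * \<psi> (prod_list (take l xs)))"
proof -
  obtain ys v where xs: "xs = ys @ [v]" using assms by (cases xs rule: rev_cases) auto
  have "\<psi> (prod_list ys * v - compress \<psi> ys v) =
      (\<Sum>l\<le>length ys. vacuum_coeff \<psi> (drop l ys) v * \<psi> (prod_list (take l ys)))"
    by (simp add: left_mult_minus_compress psi_sum psi_scaleC)
  then have "\<psi> (prod_list ys * v) =
      (\<Sum>l\<le>length ys. boolean_cumulant \<psi> (drop l ys @ [v]) * \<psi> (prod_list (take l ys)))"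
    by (simp add: psi_diff psi_compress vacuum_coeff_eq_boolean_cumulant)
  then show ?thesis by (simp add: xs lessThan_Suc_atMost)
qed

text \<open>Multiplying \<open>v\<close> by letters of \<open>S\<close> never leaves
  \<open>left_annihilated \<psi> S\<close>, which lies in the kernel of \<psi>. Hence each
  projection \<open>1 - P\<close> acts as the identity.\<close>

lemma vacuum_coeff_annihilated:
  assumes "unital_subalgebra S" "v \<in> left_annihilated \<psi> S" "set xs \<subseteq> S"
  shows "compress \<psi> xs v = prod_list xs * v" "vacuum_coeff \<psi> xs v = 0"
proof -
  have psi0: "\<psi> v = 0" if "v \<in> left_annihilated \<psi> S" for v
    using that assms(1) by (force simp: left_annihilated_def unital_subalgebra_def)
  have mult: "prod_list xs * v \<in> left_annihilated \<psi> S" if "set xs \<subseteq> S" for xs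
    by (intro left_annihilated_mult prod_list_closed assms that)
  have *: "compress \<psi> xs v = prod_list xs * v" if "set xs \<subseteq> S" for xs
    using that
  proof (induction xs)
    case Nil
    then show ?case using psi0[OF assms(2)] by (simp add: center_of_centred)
  next
    case (Cons x xs)
    then show ?case using psi0[OF mult[OF Cons.prems]]
      by (simp add: center_of_centred mult.assoc)
  qed
  then show "compress \<psi> xs v = prod_list xs * v" using assms by blast
  show "vacuum_coeff \<psi> xs v = 0"
    using * assms(3) psi0[OF mult[OF assms(3)]]
    by (cases xs) (auto simp: mult.assoc)
qed

text \<open>Every rank one term vanishes: the prefix product lies in \<open>S\<close>, and the
  suffix functional kills its image under \<open>X\<close>.\<close>

lemma defect_trace_annihilated:
  assumes "unital_subalgebra S" "set xs \<subseteq> S" "\<And>v. v \<in> S \<Longrightarrow> X v \<in> left_annihilated \<psi> S"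
  shows "defect_trace \<psi> xs X = 0"
  unfolding defect_trace_eq_sum
proof (rule sum.neutral, rule ballI)
  fix l
  have "set (take l xs) \<subseteq> S" "set (drop l xs) \<subseteq> S"
    using assms(2) by (meson set_drop_subset set_take_subset subset_trans)+
  then show "vacuum_coeff \<psi> (drop l xs) (X (prod_list (take l xs))) = 0"
    by (intro vacuum_coeff_annihilated(2)[OF assms(1)] assms(3) prod_list_closed assms(1))
qed


section \<open>The cyclic functional as a trace\<close>

text \<open>The moment-cumulant relation for a segment of the word, by induction on its first block.
  The weight \<open>f\<close> is prescribed only up to \<open>l\<close>, so that the cyclically read
  weight can be used too.\<close>

lemma sum_cut_chains_path_weight:
  assumes "k \<le> l" "l \<le> length xs"
    and "\<And>i j. i < j \<Longrightarrow> j \<le> l \<Longrightarrow> f i j = boolean_cumulant \<psi> (drop i (take j xs))"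
  shows "(\<Sum>is\<in>cut_chains k l. path_weight f is) = \<psi> (prod_list (drop k (take l xs)))"
  using assms(1)
proof (induction "l - k" arbitrary: k rule: less_induct)
  case less
  show ?case
  proof (cases "k = l")
    case True
    then show ?thesis by (simp add: cut_chains_refl psi_one)
  next
    case False
    then have kl: "k < l" using less.prems by simp
    define zs where "zs = drop k (take l xs)"
    have len: "length zs = l - k" using assms(2) by (simp add: zs_def)
    have "(\<Sum>is\<in>cut_chains k l. path_weight f is) =
        (\<Sum>k'\<in>{k<..l}. \<Sum>is\<in>(#) k ` cut_chains k' l. path_weight f is)"
      unfolding cut_chains_less[OF kl]
      by (rule sum.UNION_disjoint) (auto simp: finite_cut_chains, auto simp: cut_chains_def)
    also have "\<dots> = (\<Sum>k'\<in>{k<..l}. f k k' * \<psi> (prod_list (drop k' (take l xs))))"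
    proof (rule sum.cong[OF refl])
      fix k' assume k': "k' \<in> {k<..l}"
      have "(\<Sum>is\<in>(#) k ` cut_chains k' l. path_weight f is) = (\<Sum>is\<in>cut_chains k' l. f k k' * path_weight f is)"
        by (subst sum.reindex) (auto intro!: sum.cong simp: path_weight_Cons cut_chains_def)
      moreover have "l - k' < l - k" "k' \<le> l" using k' kl by auto
      ultimately show "(\<Sum>is\<in>(#) k ` cut_chains k' l. path_weight f is) =
          f k k' * \<psi> (prod_list (drop k' (take l xs)))"
        using less.hyps[of k'] by (simp add: sum_distrib_left[symmetric])
    qed
    also have "\<dots> = (\<Sum>d=1..l - k. f k (k + d) * \<psi> (prod_list (drop (k + d) (take l xs))))"
      using kl by (intro sum.reindex_bij_witness[of _ "\<lambda>d. k + d" "\<lambda>k'. k' - k"]) auto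
    \<comment> \<open>The empty prefix makes the sum an instance of
      \<open>vacuum_coeff_prod_list\<close> with \<open>ys = []\<close>, where
      \<open>vacuum_coeff\<close> is \<psi>.\<close>
    also have "\<dots> = (\<Sum>d=1..length zs. boolean_cumulant \<psi> ([] @ take d zs) * \<psi> (prod_list (drop d zs)))"
      unfolding len
    proof (rule sum.cong[OF refl])
      fix d assume d: "d \<in> {1..l - k}"
      then have kd: "k < k + d" "k + d \<le> l" using kl by auto
      then have "take d zs = drop k (take (k + d) xs)"
        by (simp add: zs_def take_drop min_def add.commute)
      with assms(3)[OF kd] show "f k (k + d) * \<psi> (prod_list (drop (k + d) (take l xs))) =
          boolean_cumulant \<psi> ([] @ take d zs) * \<psi> (prod_list (drop d zs))"
        by (simp add: zs_def add.commute)
    qed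
    also have "\<dots> = \<psi> (prod_list zs)"
      using kl len by (subst vacuum_coeff_prod_list[symmetric]) auto
    finally show ?thesis by (simp add: zs_def)
  qed
qed

text \<open>Group by the first cut \<open>k\<close> and the last cut \<open>l\<close>. These fix the
  block wrapping around the end of the word, and the partitions of the segment between them sum to
  its moment.\<close>

lemma cyclic_cumulant_sum_outer_cuts:
  "cyclic_cumulant_sum \<psi> xs = (\<Sum>l<length xs. \<Sum>k\<le>l.
    \<psi> (prod_list (drop k (take l xs))) * boolean_cumulant \<psi> (drop l xs @ take k xs))"
proof -
  define n where "n = length xs"
  define f where "f i j = boolean_cumulant \<psi> (map (\<lambda>m. xs ! (m mod n)) [i..<j])" for i j
  define W where "W is = path_weight f (is @ [hd is + n])" for "is"
  define S where "S = {is. is \<noteq> [] \<and> sorted_wrt (<) is \<and> set is \<subseteq> {0..<n}}"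
  have length: "length is \<le> n" if "sorted_wrt (<) is" "set is \<subseteq> {0..<n}" for "is"
    using that card_mono[of "{0..<n}" "set is"] by (auto simp: strict_sorted_iff distinct_card)
  have fin: "finite S"
    by (rule finite_subset[OF _ finite_lists_length_le[of "{0..<n}" n]]) (auto simp: S_def length)
  have "cyclic_cumulant_sum \<psi> xs =
      (\<Sum>l=1..n. \<Sum>is | length is = l \<and> sorted_wrt (<) is \<and> set is \<subseteq> {0..<n}. W is)"
    unfolding cyclic_cumulant_sum_def Let_def n_def[symmetric]
    by (intro sum.cong refl) (auto simp: W_def f_def path_weight_eq_prod)
  also have "\<dots> = (\<Sum>l=1..n. \<Sum>is\<in>{is \<in> S. length is = l}. W is)"
    by (intro sum.cong refl) (auto simp: S_def)
  also have "\<dots> = sum W S"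
    by (rule sum.group[OF fin]) (auto simp: S_def Suc_le_eq length)
  also have "\<dots> = (\<Sum>p\<in>Sigma {..<n} (\<lambda>l. {..l}). \<Sum>is\<in>{is \<in> S. (last is, hd is) = p}. W is)"
  proof (rule sum.group[OF fin, symmetric])
    show "(\<lambda>is. (last is, hd is)) ` S \<subseteq> Sigma {..<n} (\<lambda>l. {..l})"
    proof (intro image_subsetI)
      fix "is" assume "is \<in> S"
      then have *: "is \<noteq> []" "sorted_wrt (<) is" "set is \<subseteq> {0..<n}" by (auto simp: S_def)
      then have "is \<in> cut_chains (hd is) (last is)" by (simp add: cut_chains_def)
      then have "hd is \<le> last is" by (rule cut_chains_le)
      moreover have "last is < n" using * last_in_set[of "is"] by (meson atLeastLessThan_iff subsetD)
      ultimately show "(last is, hd is) \<in> Sigma {..<n} (\<lambda>l. {..l})" by simp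
    qed
  qed simp
  also have "\<dots> = (\<Sum>l<n. \<Sum>k\<le>l. \<Sum>is\<in>{is \<in> S. (last is, hd is) = (l, k)}. W is)"
    by (simp add: sum.Sigma) (auto intro!: sum.cong)
  also have "\<dots> = (\<Sum>l<n. \<Sum>k\<le>l. \<psi> (prod_list (drop k (take l xs))) *
      boolean_cumulant \<psi> (drop l xs @ take k xs))"
  proof (intro sum.cong refl)
    fix l k assume "l \<in> {..<n}" "k \<in> {..l}"
    then have l: "l < n" "k \<le> l" by auto
    have eq: "{is \<in> S. (last is, hd is) = (l, k)} = cut_chains k l"
    proof (intro set_eqI iffI)
      fix "is" assume c: "is \<in> cut_chains k l"
      then have "set is \<subseteq> {0..<n}" using l cut_chains_bounded[OF c] by fastforce
      with c show "is \<in> {is \<in> S. (last is, hd is) = (l, k)}" by (auto simp: S_def cut_chains_def)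
    qed (auto simp: S_def cut_chains_def)
    have f: "f i j = boolean_cumulant \<psi> (drop i (take j xs))" if "i < j" "j \<le> l" for i j
    proof -
      have "map (\<lambda>m. xs ! (m mod n)) [i..<j] = drop i (take j xs)"
        using that l by (intro nth_equalityI) (auto simp: n_def)
      then show ?thesis by (simp add: f_def)
    qed
    \<comment> \<open>Read modulo \<open>n\<close>, the last block is the end of the word followed
      by its first \<open>k\<close> letters.\<close>
    have wrap: "f l (k + n) = boolean_cumulant \<psi> (drop l xs @ take k xs)"
    proof -
      have "map (\<lambda>m. xs ! (m mod n)) [l..<k + n] = drop l xs @ take k xs"
      proof (rule nth_equalityI)
        show "length (map (\<lambda>m. xs ! (m mod n)) [l..<k + n]) = length (drop l xs @ take k xs)"
          using l by (simp add: n_def)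
        fix i assume "i < length (map (\<lambda>m. xs ! (m mod n)) [l..<k + n])"
        then have i: "i < k + n - l" by simp
        show "map (\<lambda>m. xs ! (m mod n)) [l..<k + n] ! i = (drop l xs @ take k xs) ! i"
        proof (cases "l + i < n")
          case True
          then have "i < n - l" by simp
          with True i l show ?thesis by (simp add: nth_append n_def)
        next
          case False
          then have "(l + i) mod n = l + i - n" using i l by (simp add: le_mod_geq)
          moreover have "l + i - n = i - (n - l)" "n - l \<le> i" using False l by simp_all
          ultimately show ?thesis using False i l by (simp add: nth_append n_def)
        qed
      qed
      then show ?thesis by (simp add: f_def)
    qed
    have "(\<Sum>is\<in>cut_chains k l. W is) = (\<Sum>is\<in>cut_chains k l. path_weight f is * f l (k + n))"
      by (intro sum.cong refl) (auto simp: W_def cut_chains_def path_weight_snoc)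
    then show "(\<Sum>is\<in>{is \<in> S. (last is, hd is) = (l, k)}. W is) =
      \<psi> (prod_list (drop k (take l xs))) * boolean_cumulant \<psi> (drop l xs @ take k xs)"
      unfolding eq
      using sum_cut_chains_path_weight[of k l xs f, OF l(2) _ f] l(1)
      by (simp add: wrap sum_distrib_right[symmetric] n_def[symmetric])
  qed
  finally show ?thesis by (simp add: n_def)
qed

text \<open>For \<open>l < length xs\<close> the terms with \<open>k \<ge> 1\<close> give the
  \<open>l\<close>-th rank one trace. Those with \<open>k = 0\<close> have no wrapping letters; by
  \<open>moment_last_block\<close> they add up to the moment, which is the remaining trace term
  \<open>l = length xs\<close>.\<close>

lemma cyclic_cumulant_sum_eq_defect_trace:
  assumes "xs \<noteq> []"
  shows "cyclic_cumulant_sum \<psi> xs = defect_trace \<psi> xs (\<lambda>v. v)"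
proof -
  let ?n = "length xs"
  let ?b = "\<lambda>l k. \<psi> (prod_list (drop k (take l xs))) * boolean_cumulant \<psi> (drop l xs @ take k xs)"
  have T: "vacuum_coeff \<psi> (drop l xs) (prod_list (take l xs)) = (\<Sum>k=1..l. ?b l k)" if "l < ?n" for l
  proof (cases "l = 0")
    case True
    then show ?thesis using assms by (simp add: vacuum_coeff_one)
  next
    case False
    then have "take l xs \<noteq> []" using assms by simp
    from vacuum_coeff_prod_list[OF this] show ?thesis using that
      by (auto intro!: sum.cong simp: min_def mult.commute)
  qed
  have "cyclic_cumulant_sum \<psi> xs = (\<Sum>l<?n. ?b l 0 + (\<Sum>k=1..l. ?b l k))"
    unfolding cyclic_cumulant_sum_outer_cuts sum_atMost_split_first ..
  also have "\<dots> = \<psi> (prod_list xs) + (\<Sum>l<?n. \<Sum>k=1..l. ?b l k)"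
    by (simp add: sum.distrib moment_last_block[OF assms] mult.commute)
  also have "\<dots> = defect_trace \<psi> xs (\<lambda>v. v)"
    using T by (simp add: defect_trace_eq_sum atMost_Suc lessThan_Suc_atMost[symmetric] add.commute)
  finally show ?thesis .
qed


section \<open>Cyclically alternating products\<close>

lemma linear_extension_compress_linear:
  "linear_extension (\<lambda>xs. compress \<psi> xs (c *\<^sub>C u + v)) p =
    c *\<^sub>C linear_extension (\<lambda>xs. compress \<psi> xs u) p + linear_extension (\<lambda>xs. compress \<psi> xs v) p"
  by (simp add: linear_extension_def compress_linear scaleC_add_right sum.distrib
      complex_vector.scale_sum_right scaleC_scaleC mult.commute)

lemma linear_extension_compress_mult:
  "linear_extension (\<lambda>xs. compress \<psi> xs v) (p * q) =
    linear_extension (\<lambda>xs. compress \<psi> xs (linear_extension (\<lambda>ys. compress \<psi> ys v) q)) p"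
proof -
  have "linear_extension (\<lambda>ys. compress \<psi> xs (compress \<psi> ys v)) q =
      compress \<psi> xs (linear_extension (\<lambda>ys. compress \<psi> ys v) q)" for xs
    by (rule linear_extension_comp) (rule compress_linear)
  then show ?thesis by (simp add: linear_extension_mult compress_append)
qed

lemma linear_extension_defect_trace_linear:
  "linear_extension (\<lambda>xs. defect_trace \<psi> xs (\<lambda>v. c *\<^sub>C X v + Y v)) p =
    c *\<^sub>C linear_extension (\<lambda>xs. defect_trace \<psi> xs X) p + linear_extension (\<lambda>xs. defect_trace \<psi> xs Y) p"
  by (simp add: linear_extension_def defect_trace_linear scaleC_complex_def)
     (simp add: sum.distrib sum_distrib_left algebra_simps)

text \<open>Extends \<open>defect_trace_append\<close> from words to polynomials. Linearity of
  \<open>X\<close> lets the sum over the words of \<open>p\<close> pass through its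
  argument.\<close>

lemma linear_extension_defect_trace_mult:
  assumes X: "\<And>c u v. X (c *\<^sub>C u + v) = c *\<^sub>C X u + X v"
  shows "linear_extension (\<lambda>xs. defect_trace \<psi> xs X) (p * q) =
    linear_extension (\<lambda>ys. defect_trace \<psi> ys (\<lambda>v. X (linear_extension prod_list p * v))) q +
    linear_extension (\<lambda>xs. defect_trace \<psi> xs (\<lambda>v. linear_extension (\<lambda>ys. compress \<psi> ys (X v)) q)) p"
proof -
  have 1: "linear_extension (\<lambda>xs. linear_extension (\<lambda>ys. defect_trace \<psi> ys (\<lambda>v. X (prod_list xs * v))) q) p =
      linear_extension (\<lambda>ys. defect_trace \<psi> ys (\<lambda>v. X (linear_extension prod_list p * v))) q"
    by (rule linear_extension_comp)
       (simp add: distrib_right mult_scaleC_left X linear_extension_defect_trace_linear)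
  have zero: "defect_trace \<psi> xs (\<lambda>v. 0) = 0" for xs
    by (simp add: defect_trace_eq_sum vacuum_coeff_zero)
  have 2: "linear_extension (\<lambda>ys. defect_trace \<psi> xs (\<lambda>v. compress \<psi> ys (X v))) q =
      defect_trace \<psi> xs (\<lambda>v. linear_extension (\<lambda>ys. compress \<psi> ys (X v)) q)" for xs
    using word_span_UNIV[of q]
    by (induction q rule: word_span_induct)
       (simp_all add: linear_extension_linear defect_trace_linear scaleC_complex_def zero)
  show ?thesis
    by (simp add: linear_extension_mult defect_trace_append linear_extension_add[symmetric] 1 2)
qed

text \<open>Splitting off factors from the left leaves one trace for each factor, the third
  assumption, and finally \<open>D(1) = P\<close>, whose contribution is the second
  assumption.\<close>

lemma linear_extension_defect_trace_prod_list:
  assumes "\<And>c u v. X (c *\<^sub>C u + v) = c *\<^sub>C X u + X v"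
    and "\<psi> (X (linear_extension prod_list (prod_list ps))) = 0"
    and "\<And>us p vs. ps = us @ p # vs \<Longrightarrow> linear_extension (\<lambda>xs. defect_trace \<psi> xs
      (\<lambda>v. linear_extension (\<lambda>ys. compress \<psi> ys
        (X (linear_extension prod_list (prod_list us) * v))) (prod_list vs))) p = 0"
  shows "linear_extension (\<lambda>xs. defect_trace \<psi> xs X) (prod_list ps) = 0"
  using assms
proof (induction ps arbitrary: X)
  case Nil
  then show ?case by simp
next
  case (Cons p ps)
  have "linear_extension (\<lambda>xs. defect_trace \<psi> xs (\<lambda>v. X (linear_extension prod_list p * v))) (prod_list ps) = 0"
  proof (rule Cons.IH)
    show "X (linear_extension prod_list p * (c *\<^sub>C u + v)) =
        c *\<^sub>C X (linear_extension prod_list p * u) + X (linear_extension prod_list p * v)" for c u v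
      by (simp add: distrib_left mult_scaleC_right Cons.prems(1))
    show "\<psi> (X (linear_extension prod_list p * linear_extension prod_list (prod_list ps))) = 0"
      using Cons.prems(2) by (simp add: linear_extension_prod_list_mult)
    fix us q vs assume "ps = us @ q # vs"
    then have "p # ps = (p # us) @ q # vs" by simp
    from Cons.prems(3)[OF this] show "linear_extension (\<lambda>xs. defect_trace \<psi> xs
      (\<lambda>v. linear_extension (\<lambda>ys. compress \<psi> ys (X (linear_extension prod_list p *
        (linear_extension prod_list (prod_list us) * v)))) (prod_list vs))) q = 0"
      by (simp add: linear_extension_prod_list_mult mult.assoc)
  qed
  with Cons.prems(3)[of "[]" p ps] show ?case
    by (simp add: linear_extension_defect_trace_mult[of X, OF Cons.prems(1)])
qed

section \<open>Consequences of freeness for the compression\<close>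

lemma subspace_left_annihilated: "module.subspace scaleC (left_annihilated \<psi> S)"
  by (auto simp: complex_vector.subspace_def left_annihilated_def psi_zero distrib_left psi_add
      mult_scaleC_right psi_scaleC)

lemma center_closed: "unital_subalgebra S \<Longrightarrow> v \<in> S \<Longrightarrow> center \<psi> v \<in> S"
  unfolding center_def unital_subalgebra_def
  by (metis complex_vector.subspace_diff complex_vector.subspace_scale)

text \<open>Write \<open>a\<close> as its centred part plus a scalar: the centred part times
  \<open>w\<close> is again alternating, and both terms vanish under \<psi>.\<close>

lemma alternating_left_annihilated:
  assumes "free_wrt I A \<psi>" "alternating I A \<psi> i w" "k \<in> I" "k \<noteq> i" "unital_subalgebra (A k)"
  shows "w \<in> left_annihilated \<psi> (A k)"
proof -
  have "\<psi> (a * w) = 0" if "a \<in> A k" for a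
  proof -
    have "\<psi> (center \<psi> a * w) = 0"
      using assms that
      by (intro free_wrt_alternating[OF assms(1), of k] alternating.mult center_closed psi_center)
    then show ?thesis using free_wrt_alternating[OF assms(1,2)]
      by (simp add: center_def left_diff_distrib mult_scaleC_left psi_diff psi_scaleC)
  qed
  then show ?thesis by (simp add: left_annihilated_def)
qed

text \<open>The two claims support each other in a downward induction on \<open>s\<close>: since the
  vector reached so far is alternating and starts in another algebra, it is annihilated by
  \<open>A (j s)\<close>, so \<open>M\<close> and \<open>L\<close> agree on it. For the empty
  segment the leading index is still \<open>i\<close>.\<close>

lemma compress_alternating_segment:
  assumes free: "free_wrt I A \<psi>"
    and A: "\<And>i. i \<in> I \<Longrightarrow> unital_subalgebra (A i)"
    and j: "\<And>k. k < e \<Longrightarrow> j k \<in> I" "\<And>k. Suc k < e \<Longrightarrow> j k \<noteq> j (Suc k)"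
    and p: "\<And>k. k < e \<Longrightarrow> p k \<in> word_span (lists (A (j k)))"
      "\<And>k. k < e \<Longrightarrow> \<psi> (linear_extension prod_list (p k)) = 0"
    and w: "alternating I A \<psi> i w" "s < e \<Longrightarrow> j (e - 1) \<noteq> i" and "s \<le> e"
  shows "alternating I A \<psi> (if s < e then j s else i)
      (linear_extension prod_list (prod_list (map p [s..<e])) * w) \<and>
    linear_extension (\<lambda>xs. compress \<psi> xs w) (prod_list (map p [s..<e])) =
      linear_extension prod_list (prod_list (map p [s..<e])) * w"
  using \<open>s \<le> e\<close> w(2)
proof (induction s rule: inc_induct)
  case base
  then show ?case using w(1) free_wrt_alternating[OF free w(1)] by (simp add: center_of_centred)
next
  case (step s)
  define u where "u = linear_extension prod_list (prod_list (map p [Suc s..<e])) * w"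
  define i' where "i' = (if Suc s < e then j (Suc s) else i)"
  have u: "alternating I A \<psi> i' u"
    "linear_extension (\<lambda>xs. compress \<psi> xs w) (prod_list (map p [Suc s..<e])) = u"
    using step.IH step.prems by (auto simp: u_def i'_def)
  have i': "j s \<noteq> i'"
  proof (cases "Suc s < e")
    case True
    then show ?thesis using j(2)[of s] by (simp add: i'_def)
  next
    case False
    then have "s = e - 1" using step.hyps by simp
    then show ?thesis using False step by (simp add: i'_def)
  qed
  have s: "j s \<in> I" "unital_subalgebra (A (j s))" "p s \<in> word_span (lists (A (j s)))"
    using j(1) A p(1) step.hyps by auto
  have split: "prod_list (map p [s..<e]) = p s * prod_list (map p [Suc s..<e])"
    using step.hyps by (simp add: upt_conv_Cons)
  have L: "linear_extension prod_list (prod_list (map p [s..<e])) * w =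
      linear_extension prod_list (p s) * u"
    by (simp add: split linear_extension_prod_list_mult u_def mult.assoc)
  have "linear_extension (\<lambda>xs. compress \<psi> xs u) (p s) = linear_extension (\<lambda>xs. prod_list xs * u) (p s)"
    using vacuum_coeff_annihilated(1)[OF s(2) alternating_left_annihilated[OF free u(1) s(1) i' s(2)]]
    by (intro linear_extension_cong[OF s(3)]) auto
  also have "\<dots> = linear_extension prod_list (p s) * u"
    by (rule linear_extension_comp) (simp add: distrib_right mult_scaleC_left)
  finally have "linear_extension (\<lambda>xs. compress \<psi> xs w) (prod_list (map p [s..<e])) =
      linear_extension prod_list (prod_list (map p [s..<e])) * w"
    by (simp add: L) (simp add: split linear_extension_compress_mult u(2))
  moreover have "alternating I A \<psi> (j s) (linear_extension prod_list (p s) * u)"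
    using s i' p(2) step.hyps
    by (intro alternating.mult[OF u(1)] linear_extension_prod_list_closed)
  ultimately show ?case using step.hyps by (simp add: L)
qed


text \<open>For each \<open>k\<close>, the operator \<open>Y\<close> composed with \<open>D\<close>
  of the \<open>k\<close>-th factor maps \<open>A (j k)\<close> into
  \<open>left_annihilated \<psi> (A (j k))\<close>. This is checked separately on \<open>1\<close>
  and on centred elements.\<close>

lemma defect_trace_cyclically_alternating:
  assumes free: "free_wrt I A \<psi>"
    and A: "\<And>i. i \<in> I \<Longrightarrow> unital_subalgebra (A i)"
    and n: "n \<ge> 2"
    and j: "\<And>k. k < n \<Longrightarrow> j k \<in> I" "\<And>k. Suc k < n \<Longrightarrow> j k \<noteq> j (Suc k)" "j (n - 1) \<noteq> j 0"
    and p: "\<And>k. k < n \<Longrightarrow> p k \<in> word_span (lists (A (j k)))"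
      "\<And>k. k < n \<Longrightarrow> \<psi> (linear_extension prod_list (p k)) = 0"
  shows "linear_extension (\<lambda>xs. defect_trace \<psi> xs (\<lambda>v. v)) (prod_list (map p [0..<n])) = 0"
proof (rule linear_extension_defect_trace_prod_list)
  let ?L = "linear_extension prod_list"
  let ?M = "\<lambda>q v. linear_extension (\<lambda>xs. compress \<psi> xs v) q"
  have L: "?L (p k) \<in> A (j k)" if "k < n" for k
    using that by (intro linear_extension_prod_list_closed A j p)
  have "\<psi> (prod_list (map (\<lambda>k. ?L (p k)) [0..<n])) = 0"
    using free[unfolded free_wrt_def, rule_format, of n j "\<lambda>k. ?L (p k)"] n L j p(2) by auto
  then show "\<psi> (?L (prod_list (map p [0..<n]))) = 0"
    by (simp add: linear_extension_prod_list_prod_list comp_def)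
  fix us q vs assume split: "map p [0..<n] = us @ q # vs"
  define k where "k = length us"
  have len: "n = length us + Suc (length vs)" using arg_cong[OF split, of length] by simp
  then have k: "k < n" by (simp add: k_def)
  have us: "us = map p [0..<k]"
    using arg_cong[OF split, of "take k"] k by (simp add: k_def take_map)
  have q: "q = p k"
    using arg_cong[OF split, of "\<lambda>xs. xs ! k"] k by (simp add: k_def)
  have vs: "vs = map p [Suc k..<n]"
    using arg_cong[OF split, of "drop (Suc k)"] k by (simp add: k_def drop_map)
  define Y where "Y v = ?M (prod_list vs) (?L (prod_list us) * v)" for v
  have Yadd: "Y (c *\<^sub>C u + v) = c *\<^sub>C Y u + Y v" for c u v
    by (simp add: Y_def distrib_left mult_scaleC_right linear_extension_compress_linear)
  note segment = compress_alternating_segment[OF free A]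
  have jk: "j k \<in> I" "unital_subalgebra (A (j k))" using j(1)[OF k] A by auto
  \<comment> \<open>The later factors end in algebra \<open>j (n - 1)\<close>, which differs from
    \<open>j 0\<close> by cyclicity, so they may be prepended to \<open>w\<close>. The same
    condition settles the case where no factor follows \<open>k\<close>.\<close>
  have last: "?M (prod_list vs) w \<in> left_annihilated \<psi> (A (j k))"
    if w: "alternating I A \<psi> (j 0) w" for w
  proof -
    have *: "alternating I A \<psi> (if Suc k < n then j (Suc k) else j 0) (?L (prod_list vs) * w) \<and>
      ?M (prod_list vs) w = ?L (prod_list vs) * w"
      unfolding vs using j p k by (intro segment w) auto
    moreover have "j k \<noteq> (if Suc k < n then j (Suc k) else j 0)"
    proof (cases "Suc k < n")
      case False
      then have "k = n - 1" using k by simp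
      then show ?thesis using False j(3) by simp
    qed (use j(2) in auto)
    ultimately show ?thesis
      using alternating_left_annihilated[OF free _ jk(1) _ jk(2)] by metis
  qed
  \<comment> \<open>For \<open>k = 0\<close> the vector \<open>1\<close> meets \<open>M\<close>
    directly and is killed. Otherwise the factor just before position \<open>k\<close> serves as the
    initial alternating word.\<close>
  have one: "Y 1 \<in> left_annihilated \<psi> (A (j k))"
  proof (cases k)
    case 0
    have "Y 1 = ?M (prod_list vs) 1" using 0 by (simp add: Y_def us)
    also have "\<dots> = 0" by (simp add: compress_one linear_extension_def)
    finally show ?thesis by (simp add: left_annihilated_def psi_zero)
  next
    case (Suc m)
    then have m: "m < n" using k by simp
    have b: "alternating I A \<psi> (j m) (?L (p m))"
      by (intro alternating.single j p L m)
    have "alternating I A \<psi> (if 0 < m then j 0 else j m) (?L (prod_list (map p [0..<m])) * ?L (p m)) \<and>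
        ?M (prod_list (map p [0..<m])) (?L (p m)) = ?L (prod_list (map p [0..<m])) * ?L (p m)"
    proof (rule segment[OF _ _ _ _ _ b])
      show "j (m - 1) \<noteq> j m" if "0 < m" using j(2)[of "m - 1"] that m by simp
    qed (use j p m in auto)
    moreover have "(if 0 < m then j 0 else j m) = j 0" by simp
    moreover have "?L (prod_list us) = ?L (prod_list (map p [0..<m])) * ?L (p m)"
      by (simp add: us Suc linear_extension_prod_list_mult)
    ultimately show ?thesis by (simp add: Y_def last)
  qed
  \<comment> \<open>Here \<open>v\<close> itself is the initial alternating word, as
    \<open>j (k - 1) \<noteq> j k\<close>.\<close>
  have centred: "Y v \<in> left_annihilated \<psi> (A (j k))" if "v \<in> A (j k)" "\<psi> v = 0" for v
  proof -
    have v: "alternating I A \<psi> (j k) v" using that jk by (intro alternating.single)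
    have "alternating I A \<psi> (if 0 < k then j 0 else j k) (?L (prod_list us) * v) \<and>
        ?M (prod_list us) v = ?L (prod_list us) * v"
      unfolding us
    proof (rule segment[OF _ _ _ _ _ v])
      show "j (k - 1) \<noteq> j k" if "0 < k" using j(2)[of "k - 1"] that k by simp
    qed (use j p k in auto)
    moreover have "(if 0 < k then j 0 else j k) = j 0" by simp
    ultimately show ?thesis by (simp add: Y_def last)
  qed
  have Y: "Y v \<in> left_annihilated \<psi> (A (j k))" if "v \<in> A (j k)" for v
  proof -
    have "v = \<psi> v *\<^sub>C 1 + center \<psi> v" by (simp add: center_def)
    then have "Y v = \<psi> v *\<^sub>C Y 1 + Y (center \<psi> v)" by (metis Yadd)
    then show ?thesis
      using one centred[OF center_closed[OF jk(2) that] psi_center]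
      by (simp add: complex_vector.subspace_add complex_vector.subspace_scale
          subspace_left_annihilated)
  qed
  have "linear_extension (\<lambda>xs. defect_trace \<psi> xs Y) (p k) = linear_extension (\<lambda>xs. 0) (p k)"
    using defect_trace_annihilated[where X = Y, OF jk(2) _ Y] by (intro linear_extension_cong[OF p(1)[OF k]]) auto
  then show "linear_extension (\<lambda>xs. defect_trace \<psi> xs (\<lambda>v. ?M (prod_list vs) (?L (prod_list us) * v))) q = 0"
    by (simp add: q Y_def[abs_def] linear_extension_def)
qed simp

section \<open>The two functionals on representatives, and the theorem\<close>

lemma cyclic_functional_abs_tensor_algebra:
  "cyclic_functional \<psi> (abs_tensor_algebra p) = linear_extension (\<lambda>xs. defect_trace \<psi> xs (\<lambda>v. v)) p"
proof (rule clinear_abs_tensor_algebra)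
  show "clinear (cyclic_functional \<psi>)" by (rule cyclic_functional_tensor[OF unital])
  show "cyclic_functional \<psi> (tensor xs) = defect_trace \<psi> xs (\<lambda>v. v)" for xs
    using cyclic_functional_tensor(2,3)[OF unital]
    by (cases "xs = []") (simp_all add: tensor_Nil psi_one cyclic_cumulant_sum_eq_defect_trace)
qed

lemma tensor_extension_abs_tensor_algebra:
  "tensor_extension \<psi> (abs_tensor_algebra p) = \<psi> (linear_extension prod_list p)"
proof -
  have "clinear \<psi>" using unital by (simp add: unital_functional_def)
  from clinear_abs_tensor_algebra[OF tensor_extension_tensor[OF this]]
  have "tensor_extension \<psi> (abs_tensor_algebra p) = linear_extension (\<lambda>xs. \<psi> (prod_list xs)) p" .
  also have "\<dots> = \<psi> (linear_extension prod_list p)"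
    by (rule linear_extension_comp) (simp add: psi_add psi_scaleC scaleC_complex_def)
  finally show ?thesis .
qed

lemma tracial_cyclic_functional: "tracial_functional (cyclic_functional \<psi>)"
proof -
  have "linear_extension (\<lambda>xs. defect_trace \<psi> xs (\<lambda>v. v)) (p * q) =
      linear_extension (\<lambda>xs. defect_trace \<psi> xs (\<lambda>v. v)) (q * p)" for p q
    unfolding linear_extension_mult
    unfolding linear_extension_def complex_vector.scale_sum_right
    by (subst sum.swap) (simp add: scaleC_scaleC mult.commute defect_trace_commute)
  then have "cyclic_functional \<psi> (s * t) = cyclic_functional \<psi> (t * s)" for s t
    by (induction s rule: tensor_algebra.abs_induct; induction t rule: tensor_algebra.abs_induct)
       (simp add: times_tensor_algebra.abs_eq cyclic_functional_abs_tensor_algebra)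
  then show ?thesis
    using cyclic_functional_tensor(1)[OF unital] by (simp add: tracial_functional_def)
qed

end

theorem corollary1p10:
  fixes \<psi> :: "'a::complex_algebra_1 \<Rightarrow> complex"
    and I :: "'i set" and A :: "'i \<Rightarrow> 'a set" and \<alpha> :: complex
  assumes "unital_functional \<psi>"
    and "\<And>i. i \<in> I \<Longrightarrow> unital_subalgebra (A i)"
    and "free_wrt I A \<psi>"
  shows "cyclically_free I (\<lambda>i. tensor_subalgebra (A i))
           (tensor_extension \<psi>) (\<lambda>t. \<alpha> * cyclic_functional \<psi> t)"
proof -
  have psi: "clinear \<psi>" "\<psi> 1 = 1" using assms(1) by (simp_all add: unital_functional_def)
  \<comment> \<open>All factors are replaced at once by word polynomials over their subalgebras;
    being centred then means that their products in the base algebra are centred for \<psi>.\<close>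
  have rep: "\<exists>p. (\<forall>k<n. p k \<in> word_span (lists (A (j k))) \<and> a k = abs_tensor_algebra (p k) \<and>
      \<psi> (linear_extension prod_list (p k)) = 0) \<and>
      prod_list (map a [0..<n]) = abs_tensor_algebra (prod_list (map p [0..<n]))"
    if a: "\<forall>k<n. j k \<in> I \<and> a k \<in> tensor_subalgebra (A (j k)) \<and> tensor_extension \<psi> (a k) = 0"
    for n j and a :: "nat \<Rightarrow> 'a tensor_algebra"
  proof -
    have "\<forall>k. \<exists>p. k < n \<longrightarrow> p \<in> word_span (lists (A (j k))) \<and> a k = abs_tensor_algebra p"
      using a by (meson tensor_subalgebra_representative)
    then obtain p where p: "\<forall>k<n. p k \<in> word_span (lists (A (j k))) \<and> a k = abs_tensor_algebra (p k)"
      by metis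
    moreover from p have "map a [0..<n] = map abs_tensor_algebra (map p [0..<n])" by simp
    then have "prod_list (map a [0..<n]) = abs_tensor_algebra (prod_list (map p [0..<n]))"
      by (simp only: abs_tensor_algebra_prod_list)
    ultimately show ?thesis
      using a by (intro exI[of _ p])
        (simp add: tensor_extension_abs_tensor_algebra[OF assms(1), symmetric])
  qed
  have "unital_functional (tensor_extension \<psi>)"
    using tensor_extension_tensor[OF psi(1)] psi(2) tensor_extension_tensor(2)[OF psi(1), of "[]"]
    by (simp add: unital_functional_def tensor_Nil)
  moreover have "tracial_functional (\<lambda>t. \<alpha> * cyclic_functional \<psi> t)"
    using tracial_cyclic_functional[OF assms(1)]
    by (simp add: tracial_functional_def clinear_mult_left)
  \<comment> \<open>The extended functional factors through the multiplication map to the base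
    algebra, which sends each factor to a centred element of \<open>A (j k)\<close>.\<close>
  moreover have "free_wrt I (\<lambda>i. tensor_subalgebra (A i)) (tensor_extension \<psi>)"
    unfolding free_wrt_def
  proof (intro allI impI)
    fix n j and a :: "nat \<Rightarrow> 'a tensor_algebra"
    assume n: "n \<ge> 1" and j: "\<forall>k. Suc k < n \<longrightarrow> j k \<noteq> j (Suc k)"
      and a: "\<forall>k<n. j k \<in> I \<and> a k \<in> tensor_subalgebra (A (j k)) \<and> tensor_extension \<psi> (a k) = 0"
    obtain p where p: "\<forall>k<n. p k \<in> word_span (lists (A (j k))) \<and>
        \<psi> (linear_extension prod_list (p k)) = 0"
      "prod_list (map a [0..<n]) = abs_tensor_algebra (prod_list (map p [0..<n]))"
      using rep[OF a] by blast
    have "\<psi> (prod_list (map (\<lambda>k. linear_extension prod_list (p k)) [0..<n])) = 0"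
    proof (rule assms(3)[unfolded free_wrt_def, rule_format, OF n])
      show "j k \<in> I \<and> linear_extension prod_list (p k) \<in> A (j k) \<and>
          \<psi> (linear_extension prod_list (p k)) = 0" if "k < n" for k
        using that a p(1) by (auto intro!: linear_extension_prod_list_closed assms(2))
    qed (use j in auto)
    then show "tensor_extension \<psi> (prod_list (map a [0..<n])) = 0"
      by (simp add: p(2) tensor_extension_abs_tensor_algebra[OF assms(1)]
          linear_extension_prod_list_prod_list comp_def)
  qed
  moreover have "cyclic_functional \<psi> (prod_list (map a [0..<n])) = 0"
    if n: "n \<ge> 2"
      and a: "\<forall>k<n. j k \<in> I \<and> a k \<in> tensor_subalgebra (A (j k)) \<and> tensor_extension \<psi> (a k) = 0"
      and j: "\<forall>k. Suc k < n \<longrightarrow> j k \<noteq> j (Suc k)" "j (n - 1) \<noteq> j 0"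
    for n j and a :: "nat \<Rightarrow> 'a tensor_algebra"
  proof -
    obtain p where p: "\<forall>k<n. p k \<in> word_span (lists (A (j k))) \<and>
        \<psi> (linear_extension prod_list (p k)) = 0"
      "prod_list (map a [0..<n]) = abs_tensor_algebra (prod_list (map p [0..<n]))"
      using rep[OF a] by blast
    show ?thesis
      unfolding p(2) cyclic_functional_abs_tensor_algebra[OF assms(1)]
      by (rule defect_trace_cyclically_alternating[OF assms(1,3,2) n])
         (use a j p(1) in auto)
  qed
  ultimately show ?thesis
    by (auto simp: cyclically_free_def unital_subalgebra_tensor_subalgebra)
qed

end
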